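(* Consider the streaming incremental aggregated gradient (sIAG) iteration $$\bm{w}^{t+1}=\bm{w}^t-\frac{\eta_t}{n}\,\bm{g}^t,\qquad \bm{g}^t=\sum_{i=1}^n\nabla f_i\big(\bm{w}^{\tau_i(t)};\bm{\xi}_i^{\tau_i(t)}\big),\qquad t\ge 0,$$ in the setting described in the context, and suppose that: (1) $F$ is $\mu$-strongly convex with $\mu>0$, and for every $i\in[n]$ and $\bm{\xi}_i\in\Xi_i$ the gradient $\bm{w}\mapsto\nabla f_i(\bm{w};\bm{\xi}_i)$ is $L$-Lipschitz continuous; (2) there is $\sigma\ge 0$ with $\mathbb{E}_{\bm{\xi}_i\sim\mathcal{D}_i}\|\nabla f_i(\bm{w};\bm{\xi}_i)-\nabla F_i(\bm{w})\|_2^2\le\sigma^2(1+\|\bm{w}-\bm{w}^\star\|_2^2)$ for all $i\in[n]$ and $\bm{w}\in\mathbb{R}^d$; (3) there is an integer $T\ge 0$ with $\tau_i(t)\ge t-T$ for all $i\in[n]$ and $t\ge 0$. Let the step sizes be $\eta_t=\beta/(t+\gamma)$, put $$C_L:=20L^2+\frac{2\sigma^2}{n},\qquad \bar\rho(T):=1+2T+\Big(\frac{\mu}{2}+\frac{5L^2}{\mu}\Big)\beta T,$$ and suppose that $\beta>4/\mu$ and $$\gamma\ \ge\ 2T+\max\left\{\frac{16C_L\beta^2}{\mu\beta-2}\bar\rho(T),\ \sqrt{\frac{8C_L\beta^2}{\mu\beta-4}\bar\rho(T)}\right\}.$$ Let $$\delta_1:=\frac{32\beta^2\bar\rho(T)}{\mu\beta-2}+1,\qquad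 \delta_2:=\gamma^2\mathcal{E}_0 .$$ Then for all $t\ge 0$, $$\mathcal{E}_t\ \le\ \frac{\delta_1}{\gamma+t}\,\frac{\sigma^2}{n}+\frac{\delta_2}{(\gamma+t)^2},$$ where $\mathcal{E}_t:=\mathbb{E}\|\bm{w}^t-\bm{w}^\star\|_2^2$.
   Context: Setting. Let $n,d\ge 1$ be integers and $[n]=\{1,\dots,n\}$. For each $i\in[n]$, $\mathcal{D}_i$ is a probability distribution on a sample space $\Xi_i$, and for each $\bm{\xi}_i\in\Xi_i$ the function $f_i(\cdot;\bm{\xi}_i):\mathbb{R}^d\to\mathbb{R}$ is continuously differentiable. Put $F_i(\bm{w}):=\mathbb{E}_{\bm{\xi}_i\sim\mathcal{D}_i}[f_i(\bm{w};\bm{\xi}_i)]$ and $F(\bm{w}):=\frac1n\sum_{i=1}^nF_i(\bm{w})$; it is assumed that stochastic gradients are unbiased, i.e. $\mathbb{E}_{\bm{\xi}_i\sim\mathcal{D}_i}[\nabla f_i(\bm{w};\bm{\xi}_i)]=\nabla F_i(\bm{w})$ for all $\bm{w}\in\mathbb{R}^d$. Let $\bm{w}^\star=\arg\min_{\bm{w}\in\mathbb{R}^d}F(\bm{w})$. Algorithm. $\mathcal{A}_t\subseteq[n]$, $t=0,1,2,\dots$, is a (deterministic) sequence of sets of active workers, and $\tau_i(t):=\max\{\tau:\ 0\le\tau\le t,\ i\in\mathcal{A}_\tau\}$ is the last iteration up to $t$ at which worker $i$ was active; it is assumed to be well defined for all $i\in[n]$, $t\ge 0$ (so every worker is active at $t=0$).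 The samples $\bm{\xi}_i^t\sim\mathcal{D}_i$, $i\in[n]$, $t\ge0$, are mutually independent, and the initial point $\bm{w}^0\in\mathbb{R}^d$ is deterministic. The step sizes $\eta_t$ are positive. All expectations $\mathbb{E}$ without subscript are over all the samples. *)

theory Defs
  imports "HOL-Probability.Probability"
begin

definition gradient :: "('a::real_inner \<Rightarrow> real) \<Rightarrow> 'a \<Rightarrow> 'a" where
  "gradient f x = (THE D. GDERIV f x :> D)"

text \<open>In finite dimension, the description above denotes the gradient exactly when the function
  is differentiable at the point.\<close>

lemma gradient_eqI:
  fixes f :: "'a::real_inner \<Rightarrow> real"
  assumes "GDERIV f x :> D"
  shows "gradient f x = D"
  unfolding gradient_def
proof (rule the_equality)
  show "GDERIV f x :> D" by (rule assms)
next
  fix D' assume "GDERIV f x :> D'"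
  then have "(\<lambda>h. inner h D') = (\<lambda>h. inner h D)"
    using assms unfolding gderiv_def by (rule has_derivative_unique)
  then have "inner h (D' - D) = 0" for h
    by (simp add: inner_diff_right fun_eq_iff)
  then show "D' = D"
    by (metis inner_eq_zero_iff right_minus_eq)
qed

lemma differentiable_imp_gderiv_gradient:
  fixes f :: "'a::euclidean_space \<Rightarrow> real"
  assumes "f differentiable (at x)"
  shows "GDERIV f x :> gradient f x"
proof -
  obtain f' where f': "(f has_derivative f') (at x)"
    using assms unfolding differentiable_def by blast
  then have lin: "linear f'"
    by (rule has_derivative_linear)
  have "f' h = inner h (\<Sum>b\<in>Basis. f' b *\<^sub>R b)" for h
  proof -
    have "f' h = f' (\<Sum>b\<in>Basis. inner h b *\<^sub>R b)"
      by (simp add: euclidean_representation)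
    also have "\<dots> = (\<Sum>b\<in>Basis. inner h b *\<^sub>R f' b)"
      using lin by (simp add: linear_sum linear_cmul)
    also have "\<dots> = inner h (\<Sum>b\<in>Basis. f' b *\<^sub>R b)"
      by (simp add: inner_sum_right mult.commute)
    finally show ?thesis .
  qed
  then have "f' = (\<lambda>h. inner h (\<Sum>b\<in>Basis. f' b *\<^sub>R b))"
    by blast
  with f' have "GDERIV f x :> (\<Sum>b\<in>Basis. f' b *\<^sub>R b)"
    unfolding gderiv_def by metis
  then show ?thesis
    using gradient_eqI by metis
qed

definition C1_fun :: "('a::real_inner \<Rightarrow> real) \<Rightarrow> bool" where
  "C1_fun f \<longleftrightarrow> (\<forall>x. f differentiable (at x)) \<and> continuous_on UNIV (gradient f)"

definition strongly_convex_on :: "real \<Rightarrow> 'a::real_normed_vector set \<Rightarrow> ('a \<Rightarrow> real) \<Rightarrow> bool" where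
  "strongly_convex_on \<mu> S f \<longleftrightarrow> convex S \<and>
    (\<forall>x\<in>S. \<forall>y\<in>S. \<forall>u\<ge>0. \<forall>v\<ge>0. u + v = 1 \<longrightarrow>
      f (u *\<^sub>R x + v *\<^sub>R y) \<le> u * f x + v * f y - \<mu> / 2 * u * v * (norm (x - y))\<^sup>2)"

definition local_risk :: "(nat \<Rightarrow> 'x measure) \<Rightarrow> (nat \<Rightarrow> 'a \<Rightarrow> 'x \<Rightarrow> real) \<Rightarrow> nat \<Rightarrow> 'a \<Rightarrow> real" where
  "local_risk \<D> f i v = (\<integral>x. f i v x \<partial>\<D> i)"

definition average_risk ::
    "nat \<Rightarrow> (nat \<Rightarrow> 'x measure) \<Rightarrow> (nat \<Rightarrow> 'a \<Rightarrow> 'x \<Rightarrow> real) \<Rightarrow> 'a \<Rightarrow> real" where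
  "average_risk n \<D> f v = (1 / real n) * (\<Sum>i=1..n. local_risk \<D> f i v)"

text \<open>Meaningful only if worker \<open>i\<close> has been active at least once up to iteration \<open>t\<close>.\<close>

definition last_active :: "(nat \<Rightarrow> nat set) \<Rightarrow> nat \<Rightarrow> nat \<Rightarrow> nat" where
  "last_active \<A> i t = Max {s. s \<le> t \<and> i \<in> \<A> s}"

end

theory Submission
  imports Defs
begin

text \<open>Split the aggregated direction at time \<open>t\<close> into the gradient of \<open>F\<close> at \<open>w t\<close>, the drift
  caused by stale iterates, and the averaged noise. The gradient contracts the error at rate
  \<open>2 \<mu> \<eta>\<close>, half of which is spent on absorbing the drift. Noises of different workers are
  uncorrelated even when drawn at different times, since the later one is centred given the past;
  hence the averaged noise has second moment of order \<open>\<sigma>\<^sup>2 / n\<close>. The averaged noise is correlated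
  with the current error but orthogonal to the error at time \<open>t - T\<close>, and the difference of
  the two errors is a sum of at most \<open>T\<close> steps, each of order \<open>\<eta>\<close>. Monotonicity and the Lipschitz
  bound give \<open>\<mu> \<le> L\<close>, so that the lower bound on \<open>\<gamma>\<close> forces \<open>\<gamma> \<ge> 4 T + \<mu> \<beta>\<close>. Therefore
  step sizes and claimed error bounds change by at most the factors 2 and 4 over a window of length
  \<open>2 T\<close>, which yields a scalar recursion that closes by induction.\<close>

subsection \<open>Square-integrable vector-valued functions\<close>

lemma norm_sum_power2_le:
  fixes v :: "'i \<Rightarrow> 'a::real_normed_vector"
  shows "(norm (\<Sum>i\<in>I. v i))\<^sup>2 \<le> real (card I) * (\<Sum>i\<in>I. (norm (v i))\<^sup>2)"
proof -
  have "(norm (\<Sum>i\<in>I. v i))\<^sup>2 \<le> (\<Sum>i\<in>I. norm (v i))\<^sup>2"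
    by (intro power_mono norm_sum) auto
  also have "\<dots> \<le> (\<Sum>i\<in>I. (norm (v i))\<^sup>2) * real (card I)"
    by (rule sum_squared_le_sum_of_squares)
  finally show ?thesis by (simp add: mult.commute)
qed

lemma norm_add_power2_le:
  fixes u v :: "'a::real_inner"
  shows "(norm (u + v))\<^sup>2 \<le> 2 * (norm u)\<^sup>2 + 2 * (norm v)\<^sup>2"
proof -
  have "(norm (u + v))\<^sup>2 + (norm (u - v))\<^sup>2 = 2 * (norm u)\<^sup>2 + 2 * (norm v)\<^sup>2"
    by (simp add: power2_norm_eq_inner inner_add inner_diff inner_commute)
  then show ?thesis by (smt (verit) zero_le_power2)
qed

lemma abs_inner_le_half_sum_power2:
  fixes u v :: "'a::real_inner"
  shows "\<bar>u \<bullet> v\<bar> \<le> ((norm u)\<^sup>2 + (norm v)\<^sup>2) / 2"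
proof -
  have "\<bar>u \<bullet> v\<bar> \<le> norm u * norm v" by (rule Cauchy_Schwarz_ineq2)
  also have "\<dots> \<le> ((norm u)\<^sup>2 + (norm v)\<^sup>2) / 2"
    using sum_squares_bound[of "norm u" "norm v"] by simp
  finally show ?thesis .
qed

definition square_integrable :: "'s measure \<Rightarrow> ('s \<Rightarrow> 'a::euclidean_space) \<Rightarrow> bool" where
  "square_integrable M X \<longleftrightarrow>
    X \<in> borel_measurable M \<and> integrable M (\<lambda>\<omega>. (norm (X \<omega>))\<^sup>2)"

lemma square_integrable_norm_power2: "square_integrable M X \<Longrightarrow> integrable M (\<lambda>\<omega>. (norm (X \<omega>))\<^sup>2)"
  by (simp add: square_integrable_def)

lemma square_integrable_cong:
  assumes "\<And>\<omega>. \<omega> \<in> space M \<Longrightarrow> X \<omega> = Y \<omega>"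
  shows "square_integrable M X \<longleftrightarrow> square_integrable M Y"
  unfolding square_integrable_def using assms
  by (auto cong: measurable_cong Bochner_Integration.integrable_cong)

lemma square_integrable_add:
  assumes "square_integrable M X" "square_integrable M Y"
  shows "square_integrable M (\<lambda>\<omega>. X \<omega> + Y \<omega>)"
  unfolding square_integrable_def
proof
  show [measurable]: "(\<lambda>\<omega>. X \<omega> + Y \<omega>) \<in> borel_measurable M"
    using assms by (auto simp: square_integrable_def)
  have "integrable M (\<lambda>\<omega>. 2 * (norm (X \<omega>))\<^sup>2 + 2 * (norm (Y \<omega>))\<^sup>2)"
    using assms by (auto simp: square_integrable_def)
  then show "integrable M (\<lambda>\<omega>. (norm (X \<omega> + Y \<omega>))\<^sup>2)"
    by (rule Bochner_Integration.integrable_bound) (auto intro!: norm_add_power2_le)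
qed

lemma square_integrable_scaleR:
  "square_integrable M X \<Longrightarrow> square_integrable M (\<lambda>\<omega>. c *\<^sub>R X \<omega>)"
  by (auto simp: square_integrable_def power_mult_distrib)

lemma square_integrable_diff:
  "square_integrable M X \<Longrightarrow> square_integrable M Y \<Longrightarrow> square_integrable M (\<lambda>\<omega>. X \<omega> - Y \<omega>)"
  using square_integrable_add[of M X "\<lambda>\<omega>. (- 1) *\<^sub>R Y \<omega>"] square_integrable_scaleR[of M Y "- 1"]
  by simp

lemma (in finite_measure) square_integrable_const: "square_integrable M (\<lambda>_. c)"
  by (auto simp: square_integrable_def)

lemma square_integrable_sum:
  assumes "\<And>i. i \<in> I \<Longrightarrow> square_integrable M (X i)"
  shows "square_integrable M (\<lambda>\<omega>. \<Sum>i\<in>I. X i \<omega>)"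
  using assms
  by (induction I rule: infinite_finite_induct)
    (auto simp: square_integrable_add, auto simp: square_integrable_def)

lemma square_integrable_bound:
  assumes "square_integrable M Y" "X \<in> borel_measurable M"
    and "\<And>\<omega>. \<omega> \<in> space M \<Longrightarrow> norm (X \<omega>) \<le> norm (Y \<omega>)"
  shows "square_integrable M X"
  unfolding square_integrable_def
proof
  note [measurable] = assms(2)
  show "X \<in> borel_measurable M" by fact
  show "integrable M (\<lambda>\<omega>. (norm (X \<omega>))\<^sup>2)"
    by (rule Bochner_Integration.integrable_bound[OF square_integrable_norm_power2[OF assms(1)]])
      (auto intro!: power_mono assms(3))
qed

lemma square_integrable_inner:
  assumes "square_integrable M X" "square_integrable M Y"
  shows "integrable M (\<lambda>\<omega>. X \<omega> \<bullet> Y \<omega>)"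
proof (rule Bochner_Integration.integrable_bound)
  show "integrable M (\<lambda>\<omega>. ((norm (X \<omega>))\<^sup>2 + (norm (Y \<omega>))\<^sup>2) / 2)"
    using assms by (auto simp: square_integrable_def)
  show "(\<lambda>\<omega>. X \<omega> \<bullet> Y \<omega>) \<in> borel_measurable M"
    using assms by (auto simp: square_integrable_def)
  have "norm (X \<omega> \<bullet> Y \<omega>) \<le> norm (((norm (X \<omega>))\<^sup>2 + (norm (Y \<omega>))\<^sup>2) / 2)" for \<omega>
    using abs_inner_le_half_sum_power2[of "X \<omega>" "Y \<omega>"] by simp
  then show "AE \<omega> in M. norm (X \<omega> \<bullet> Y \<omega>) \<le> norm (((norm (X \<omega>))\<^sup>2 + (norm (Y \<omega>))\<^sup>2) / 2)"
    by simp
qed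

subsection \<open>Measurability and independence\<close>

text \<open>\<open>v\<close> is approximated by the first point of a countable dense sequence that is
  \<open>1 / (k + 1)\<close>-close to it.\<close>

lemma borel_measurable_Caratheodory:
  fixes G :: "'a::{second_countable_topology, metric_space} \<Rightarrow> 'x \<Rightarrow> 'b::metric_space"
  assumes meas: "\<And>v. G v \<in> borel_measurable N"
    and cont: "\<And>x. x \<in> space N \<Longrightarrow> continuous_on UNIV (\<lambda>v. G v x)"
  shows "(\<lambda>(v, x). G v x) \<in> borel_measurable (borel \<Otimes>\<^sub>M N)"
proof -
  obtain D :: "'a set" where D: "countable D" "\<And>X. open X \<Longrightarrow> X \<noteq> {} \<Longrightarrow> \<exists>d\<in>D. d \<in> X"
    using countable_dense_setE[where 'a = 'a] by blast
  have "D \<noteq> {}" using D(2)[of UNIV] by auto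
  define q where "q = from_nat_into D"
  define j where "j = (\<lambda>k v. LEAST m. dist v (q m) < 1 / real (Suc k))"
  have close: "dist v (q (j k v)) < 1 / real (Suc k)" for k v
  proof -
    obtain d where "d \<in> D" "d \<in> ball v (1 / real (Suc k))"
      using D(2)[of "ball v (1 / real (Suc k))"] by auto
    moreover obtain m where "d = q m"
      using from_nat_into_surj[OF D(1) \<open>d \<in> D\<close>] unfolding q_def by metis
    ultimately have "dist v (q m) < 1 / real (Suc k)" by simp
    then show ?thesis unfolding j_def by (rule LeastI)
  qed
  have lim: "(\<lambda>k. q (j k v)) \<longlonglongrightarrow> v" for v
  proof (rule metric_LIMSEQ_I)
    fix r :: real assume "0 < r"
    then obtain m where m: "1 / real (Suc m) < r" using nat_approx_posE by blast
    have "dist (q (j k v)) v < r" if "k \<ge> m" for k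
    proof -
      have "1 / real (Suc k) \<le> 1 / real (Suc m)" using that by (simp add: frac_le)
      then show ?thesis using close[of v k] m by (simp add: dist_commute)
    qed
    then show "\<exists>no. \<forall>k\<ge>no. dist (q (j k v)) v < r" by blast
  qed
  show ?thesis
  proof (rule borel_measurable_LIMSEQ_metric)
    fix k
    have [measurable]: "j k \<in> borel \<rightarrow>\<^sub>M count_space UNIV"
      unfolding j_def by measurable
    note [measurable] = meas
    \<comment> \<open>The index takes countably many values, so it suffices that each fixed
      \<open>q m\<close> gives a measurable function of the second coordinate.\<close>
    have "(\<lambda>z. G (q (j k (fst z))) (snd z)) \<in> borel_measurable (borel \<Otimes>\<^sub>M N)"
      by (rule measurable_compose_countable[where f = "\<lambda>m z. G (q m) (snd z)"]) measurable
    then show "(\<lambda>(v, x). G (q (j k v)) x) \<in> borel_measurable (borel \<Otimes>\<^sub>M N)"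
      by (simp add: case_prod_beta')
  next
    fix z assume "z \<in> space ((borel :: 'a measure) \<Otimes>\<^sub>M N)"
    then have "snd z \<in> space N" by (auto simp: space_pair_measure)
    from continuous_on_tendsto_compose[OF cont[OF this] lim, of "fst z"]
    show "(\<lambda>k. case z of (v, x) \<Rightarrow> G (q (j k v)) x) \<longlonglongrightarrow> (case z of (v, x) \<Rightarrow> G v x)"
      by (simp add: case_prod_beta)
  qed
qed

context prob_space
begin

text \<open>Tonelli and Fubini for independent pairs: the joint law is a product, so
  \<open>X\<close> can be integrated out with \<open>Y\<close> frozen. This replaces conditional
  expectations. The nonnegative version proves finiteness of second moments, the real one evaluates
  correlations.\<close>

lemma
  assumes X[measurable]: "X \<in> M \<rightarrow>\<^sub>M S" and Y[measurable]: "Y \<in> M \<rightarrow>\<^sub>M T"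
    and joint: "distr M S X \<Otimes>\<^sub>M distr M T Y = distr M (S \<Otimes>\<^sub>M T) (\<lambda>\<omega>. (X \<omega>, Y \<omega>))"
  shows nn_integral_independent_pair:
      "\<Phi> \<in> borel_measurable (S \<Otimes>\<^sub>M T) \<Longrightarrow>
       (\<integral>\<^sup>+\<omega>. \<Phi> (X \<omega>, Y \<omega>) \<partial>M) = (\<integral>\<^sup>+\<omega>. (\<integral>\<^sup>+x. \<Phi> (x, Y \<omega>) \<partial>distr M S X) \<partial>M)"
    and expectation_independent_pair:
      "\<Psi> \<in> borel_measurable (S \<Otimes>\<^sub>M T) \<Longrightarrow> integrable M (\<lambda>\<omega>. \<Psi> (X \<omega>, Y \<omega>) :: real) \<Longrightarrow>
       expectation (\<lambda>\<omega>. \<Psi> (X \<omega>, Y \<omega>)) = expectation (\<lambda>\<omega>. \<integral>x. \<Psi> (x, Y \<omega>) \<partial>distr M S X)"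
proof -
  interpret X: prob_space "distr M S X" by (rule prob_space_distr) fact
  interpret Y: prob_space "distr M T Y" by (rule prob_space_distr) fact
  interpret XY: pair_sigma_finite "distr M S X" "distr M T Y" ..
  show "(\<integral>\<^sup>+\<omega>. \<Phi> (X \<omega>, Y \<omega>) \<partial>M) = (\<integral>\<^sup>+\<omega>. (\<integral>\<^sup>+x. \<Phi> (x, Y \<omega>) \<partial>distr M S X) \<partial>M)"
    if [measurable]: "\<Phi> \<in> borel_measurable (S \<Otimes>\<^sub>M T)"
  proof -
    have "(\<integral>\<^sup>+\<omega>. \<Phi> (X \<omega>, Y \<omega>) \<partial>M) = integral\<^sup>N (distr M S X \<Otimes>\<^sub>M distr M T Y) \<Phi>"
      unfolding joint by (subst nn_integral_distr) auto
    also have "\<dots> = (\<integral>\<^sup>+y. (\<integral>\<^sup>+x. \<Phi> (x, y) \<partial>distr M S X) \<partial>distr M T Y)"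
      by (rule XY.nn_integral_snd[symmetric]) simp
    also have "\<dots> = (\<integral>\<^sup>+\<omega>. (\<integral>\<^sup>+x. \<Phi> (x, Y \<omega>) \<partial>distr M S X) \<partial>M)"
      by (subst nn_integral_distr) auto
    finally show ?thesis .
  qed
  show "expectation (\<lambda>\<omega>. \<Psi> (X \<omega>, Y \<omega>)) = expectation (\<lambda>\<omega>. \<integral>x. \<Psi> (x, Y \<omega>) \<partial>distr M S X)"
    if [measurable]: "\<Psi> \<in> borel_measurable (S \<Otimes>\<^sub>M T)"
      and int: "integrable M (\<lambda>\<omega>. \<Psi> (X \<omega>, Y \<omega>))"
  proof -
    have int': "integrable (distr M S X \<Otimes>\<^sub>M distr M T Y) \<Psi>"
      unfolding joint using int by (subst integrable_distr_eq) auto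
    have "expectation (\<lambda>\<omega>. \<Psi> (X \<omega>, Y \<omega>)) = integral\<^sup>L (distr M S X \<Otimes>\<^sub>M distr M T Y) \<Psi>"
      unfolding joint by (subst integral_distr) auto
    also have "\<dots> = (\<integral>y. (\<integral>x. \<Psi> (x, y) \<partial>distr M S X) \<partial>distr M T Y)"
      using XY.integral_snd[of "\<lambda>x y. \<Psi> (x, y)"] int' by simp
    also have "\<dots> = expectation (\<lambda>\<omega>. \<integral>x. \<Psi> (x, Y \<omega>) \<partial>distr M S X)"
      by (subst integral_distr) auto
    finally show ?thesis .
  qed
qed

text \<open>For measurable variables this is a sub-sigma-algebra of \<open>M\<close>, pulled back
  from the product along the tuple over \<open>J\<close>. Probabilities on it are taken from
  \<open>M\<close> through \<open>distr M\<close>.\<close>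

definition generated_by :: "('i \<Rightarrow> 'b measure) \<Rightarrow> ('i \<Rightarrow> 'a \<Rightarrow> 'b) \<Rightarrow> 'i set \<Rightarrow> 'a measure" where
  "generated_by N X J = vimage_algebra (space M) (\<lambda>\<omega>. \<lambda>j\<in>J. X j \<omega>) (PiM J N)"

lemma space_generated_by[simp]: "space (generated_by N X J) = space M"
  by (simp add: generated_by_def)

lemma measurable_generated_by:
  assumes "j \<in> J" "\<And>k. k \<in> J \<Longrightarrow> random_variable (N k) (X k)"
  shows "X j \<in> generated_by N X J \<rightarrow>\<^sub>M N j"
proof -
  have "(\<lambda>\<omega>. \<lambda>j\<in>J. X j \<omega>) \<in> generated_by N X J \<rightarrow>\<^sub>M PiM J N"
    unfolding generated_by_def
    using assms(2) by (intro measurable_vimage_algebra1) (auto simp: space_PiM intro: measurable_space)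
  from measurable_compose[OF this measurable_component_singleton[OF assms(1)]]
  show ?thesis using assms(1) by simp
qed

lemma measurable_generated_by_imp:
  assumes "\<And>k. k \<in> J \<Longrightarrow> random_variable (N k) (X k)"
    and "Y \<in> generated_by N X J \<rightarrow>\<^sub>M K"
  shows "Y \<in> M \<rightarrow>\<^sub>M K"
proof -
  have "(\<lambda>\<omega>. \<omega>) \<in> M \<rightarrow>\<^sub>M generated_by N X J"
    unfolding generated_by_def using assms(1) by (intro measurable_vimage_algebra2 measurable_restrict) auto
  from measurable_compose[OF this assms(2)] show ?thesis .
qed

text \<open>Every event of \<open>G\<close> is the preimage of an event of the product space under
  the tuple over \<open>J\<close>, and this tuple is independent of \<open>X i\<close>. With the
  identity map as second component, any \<open>G\<close>-measurable quantity can later be frozen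
  directly, without being written as a function of the tuple.\<close>

lemma distr_pair_generated_by:
  assumes indep: "indep_vars N X I" and J: "J \<subseteq> I" and i: "i \<in> I" "i \<notin> J"
  defines "G \<equiv> generated_by N X J"
  shows "(\<lambda>\<omega>. \<omega>) \<in> M \<rightarrow>\<^sub>M G"
    and "distr M (N i) (X i) \<Otimes>\<^sub>M distr M G (\<lambda>\<omega>. \<omega>) = distr M (N i \<Otimes>\<^sub>M G) (\<lambda>\<omega>. (X i \<omega>, \<omega>))"
proof -
  have rv: "random_variable (N k) (X k)" if "k \<in> I" for k
    using indep that by (auto simp: indep_vars_def)
  have rv_J: "random_variable (N k) (X k)" if "k \<in> J" for k
    using rv J that by blast
  note X[measurable] = rv[OF i(1)]
  let ?Xi = "\<lambda>\<omega>. \<lambda>j\<in>{i}. X j \<omega>" and ?XJ = "\<lambda>\<omega>. \<lambda>j\<in>J. X j \<omega>"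
  have iv: "indep_var (PiM {i} N) ?Xi (PiM J N) ?XJ"
    using J i by (intro indep_var_restrict[OF indep]) auto
  have maps: "?XJ \<in> space M \<rightarrow> space (PiM J N)"
    using rv_J by (auto simp: space_PiM intro: measurable_space)
  show id[measurable]: "(\<lambda>\<omega>. \<omega>) \<in> M \<rightarrow>\<^sub>M G"
    using measurable_generated_by_imp[of J X N "\<lambda>\<omega>. \<omega>" G] rv_J by (auto simp: G_def)
  interpret Xi: prob_space "distr M (N i) (X i)" by (rule prob_space_distr) measurable
  interpret G: prob_space "distr M G (\<lambda>\<omega>. \<omega>)" by (rule prob_space_distr) measurable
  show "distr M (N i) (X i) \<Otimes>\<^sub>M distr M G (\<lambda>\<omega>. \<omega>) = distr M (N i \<Otimes>\<^sub>M G) (\<lambda>\<omega>. (X i \<omega>, \<omega>))"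
  \<comment> \<open>Both sides are compared on rectangles, where independence is a product
    formula.\<close>
  proof (rule pair_measure_eqI)
    show "sets (distr M (N i) (X i) \<Otimes>\<^sub>M distr M G (\<lambda>\<omega>. \<omega>)) = sets (distr M (N i \<Otimes>\<^sub>M G) (\<lambda>\<omega>. (X i \<omega>, \<omega>)))"
      by (simp cong: sets_pair_measure_cong)
    fix A B assume "A \<in> sets (distr M (N i) (X i))" "B \<in> sets (distr M G (\<lambda>\<omega>. \<omega>))"
    then have A[measurable]: "A \<in> sets (N i)" and B[measurable]: "B \<in> sets G" by auto
    obtain B' where B': "B' \<in> sets (PiM J N)" "B = ?XJ -` B' \<inter> space M"
      using B sets_vimage_algebra2[OF maps] unfolding G_def generated_by_def by auto
    \<comment> \<open>Independence of blocks is phrased for tuples, so \<open>A\<close> is lifted to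
      the product over the singleton \<open>{i}\<close>.\<close>
    let ?A = "(\<lambda>x. x i) -` A \<inter> space (PiM {i} N)"
    have "?A \<in> sets (PiM {i} N)" by measurable
    from indep_varD[OF iv this B'(1)]
    have "prob ((\<lambda>\<omega>. (?Xi \<omega>, ?XJ \<omega>)) -` (?A \<times> B') \<inter> space M)
        = prob (?Xi -` ?A \<inter> space M) * prob (?XJ -` B' \<inter> space M)" .
    moreover have "?Xi -` ?A \<inter> space M = X i -` A \<inter> space M"
      using X by (auto simp: space_PiM dest: measurable_space[OF X])
    moreover have "(\<lambda>\<omega>. (?Xi \<omega>, ?XJ \<omega>)) -` (?A \<times> B') \<inter> space M = X i -` A \<inter> B"
      unfolding B'(2) by (auto simp: space_PiM dest: measurable_space[OF X])
    ultimately have eq: "prob (X i -` A \<inter> B) = prob (X i -` A \<inter> space M) * prob B"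
      using B'(2) by simp
    have "B \<subseteq> space M" using B' by auto
    then have *: "B \<inter> space M = B" "(\<lambda>\<omega>. (X i \<omega>, \<omega>)) -` (A \<times> B) \<inter> space M = X i -` A \<inter> B"
      by auto
    show "emeasure (distr M (N i) (X i)) A * emeasure (distr M G (\<lambda>\<omega>. \<omega>)) B
        = emeasure (distr M (N i \<Otimes>\<^sub>M G) (\<lambda>\<omega>. (X i \<omega>, \<omega>))) (A \<times> B)"
      by (simp add: emeasure_distr * emeasure_eq_measure eq ennreal_mult)
  qed (rule Xi.sigma_finite_measure_axioms G.sigma_finite_measure_axioms)+
qed

end

lemma norm_sum_power2_eq:
  fixes v :: "'i \<Rightarrow> 'a::real_inner"
  shows "(norm (\<Sum>i\<in>I. v i))\<^sup>2 = (\<Sum>i\<in>I. \<Sum>j\<in>I. v i \<bullet> v j)"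
  unfolding power2_norm_eq_inner by (subst inner_sum_left) (simp add: inner_sum_right)

subsection \<open>Strong convexity\<close>

text \<open>Convexity along the segment from \<open>x\<close> to \<open>y\<close>, divided by the
  parameter \<open>u\<close>, bounds a difference quotient; letting \<open>u\<close> tend to 0 from
  the right yields the first-order inequality.\<close>

lemma strongly_convex_on_gradient:
  fixes F :: "'a::real_inner \<Rightarrow> real"
  assumes sc: "strongly_convex_on \<mu> UNIV F" and F: "GDERIV F x :> D"
  shows "F x + (y - x) \<bullet> D + \<mu> / 2 * (norm (y - x))\<^sup>2 \<le> F y"
proof -
  define \<phi> where "\<phi> = (\<lambda>u. F (x + u *\<^sub>R (y - x)))"
  have "((\<lambda>u. x + u *\<^sub>R (y - x)) has_derivative (\<lambda>h. h *\<^sub>R (y - x))) (at 0)"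
    by (auto intro!: derivative_eq_intros)
  moreover have "(F has_derivative (\<lambda>h. h \<bullet> D)) (at (x + 0 *\<^sub>R (y - x)))"
    using F by (simp add: gderiv_def)
  ultimately have "(\<phi> has_derivative (\<lambda>h. (h *\<^sub>R (y - x)) \<bullet> D)) (at 0)"
    unfolding \<phi>_def by (rule has_derivative_compose)
  then have "(\<phi> has_real_derivative (y - x) \<bullet> D) (at 0)"
    unfolding has_field_derivative_def by (simp add: mult.commute[of _ "(y - x) \<bullet> D"])
  then have "((\<lambda>u. (\<phi> (0 + u) - \<phi> 0) / u) \<longlongrightarrow> (y - x) \<bullet> D) (at 0)"
    unfolding DERIV_def .
  then have lim: "((\<lambda>u. (\<phi> u - \<phi> 0) / u) \<longlongrightarrow> (y - x) \<bullet> D) (at_right 0)"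
    by (simp add: filterlim_at_split)
  have "((\<lambda>u. F y - F x - \<mu> / 2 * (1 - u) * (norm (y - x))\<^sup>2) \<longlongrightarrow>
      F y - F x - \<mu> / 2 * (1 - 0) * (norm (y - x))\<^sup>2) (at_right 0)"
    by (intro tendsto_intros)
  moreover have "\<forall>\<^sub>F u in at_right 0. (\<phi> u - \<phi> 0) / u
      \<le> F y - F x - \<mu> / 2 * (1 - u) * (norm (y - x))\<^sup>2"
  proof (rule eventually_at_rightI)
    show "(0::real) < 1" by simp
    fix u :: real assume u: "u \<in> {0<..<1}"
    have "F ((1 - u) *\<^sub>R x + u *\<^sub>R y)
        \<le> (1 - u) * F x + u * F y - \<mu> / 2 * (1 - u) * u * (norm (x - y))\<^sup>2"
      using sc u unfolding strongly_convex_on_def by simp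
    moreover have "(1 - u) *\<^sub>R x + u *\<^sub>R y = x + u *\<^sub>R (y - x)"
      by (simp add: algebra_simps)
    ultimately have "\<phi> u - \<phi> 0 \<le> u * (F y - F x - \<mu> / 2 * (1 - u) * (norm (y - x))\<^sup>2)"
      by (simp add: \<phi>_def algebra_simps norm_minus_commute)
    then show "(\<phi> u - \<phi> 0) / u \<le> F y - F x - \<mu> / 2 * (1 - u) * (norm (y - x))\<^sup>2"
      using u by (simp add: divide_le_eq mult.commute)
  qed
  ultimately have "(y - x) \<bullet> D \<le> F y - F x - \<mu> / 2 * (1 - 0) * (norm (y - x))\<^sup>2"
    using lim by (intro tendsto_le[OF trivial_limit_at_right_real])
  then show ?thesis by simp
qed

text \<open>The second claim is the sum of the first-order inequalities at \<open>v\<close> and at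
  \<open>z\<close>: each contributes \<open>\<mu> / 2\<close>, the function values cancel, and the
  gradient at the minimizer vanishes.\<close>

lemma strongly_convex_on_minimizer:
  fixes F :: "'a::real_inner \<Rightarrow> real"
  assumes sc: "strongly_convex_on \<mu> UNIV F" and F: "\<And>v. GDERIV F v :> D v"
    and min: "\<And>v. F z \<le> F v"
  shows "D z = 0" and "\<mu> * (norm (v - z))\<^sup>2 \<le> (v - z) \<bullet> D v"
proof -
  have "(F has_derivative (\<lambda>h. h \<bullet> D z)) (at z)" using F by (simp add: gderiv_def)
  then have "(\<lambda>h. h \<bullet> D z) = (\<lambda>_. 0)"
    using min by (intro differential_zero_maxmin[of z UNIV F]) auto
  then have "D z \<bullet> D z = 0" by meson
  then show z: "D z = 0" by simp
  show "\<mu> * (norm (v - z))\<^sup>2 \<le> (v - z) \<bullet> D v"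
    using strongly_convex_on_gradient[OF sc F, of v z] strongly_convex_on_gradient[OF sc F, of z v]
    by (simp add: z norm_minus_commute inner_diff_left)
qed

subsection \<open>Aggregated stochastic gradients with bounded delays\<close>

text \<open>The objective is abstracted away: \<open>G\<close> stands for the sample gradients and
  \<open>mean\<close> for their expectations. Strong convexity survives as \<open>mean_zero\<close>
  and \<open>mean_monotone\<close> at the minimizer \<open>z\<close>, the activity pattern as bounds
  on \<open>\<tau>\<close>. The difference \<open>t - T\<close> is truncated at 0, so the windows of
  the first iterations start at time 0.\<close>

locale delayed_gradient_method = prob_space M for M :: "'s measure" +
  fixes n T :: nat
    and D :: "nat \<Rightarrow> 'x measure"
    and G :: "nat \<Rightarrow> 'a::euclidean_space \<Rightarrow> 'x \<Rightarrow> 'a"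
    and mean :: "nat \<Rightarrow> 'a \<Rightarrow> 'a"
    and z w0 :: 'a
    and \<tau> :: "nat \<Rightarrow> nat \<Rightarrow> nat"
    and \<xi> :: "nat \<Rightarrow> nat \<Rightarrow> 's \<Rightarrow> 'x"
    and w :: "nat \<Rightarrow> 's \<Rightarrow> 'a"
    and \<eta> :: "nat \<Rightarrow> real"
    and \<mu> L \<sigma> :: real
  assumes n_pos: "n \<ge> 1"
    and prob_D: "i \<in> {1..n} \<Longrightarrow> prob_space (D i)"
    and G_lipschitz: "i \<in> {1..n} \<Longrightarrow> x \<in> space (D i) \<Longrightarrow> L-lipschitz_on UNIV (\<lambda>v. G i v x)"
    and G_integrable: "i \<in> {1..n} \<Longrightarrow> integrable (D i) (G i v)"
    and G_mean: "i \<in> {1..n} \<Longrightarrow> (\<integral>x. G i v x \<partial>D i) = mean i v"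
    and G_variance_integrable: "i \<in> {1..n} \<Longrightarrow> integrable (D i) (\<lambda>x. (norm (G i v x - mean i v))\<^sup>2)"
    and G_variance: "i \<in> {1..n} \<Longrightarrow>
      (\<integral>x. (norm (G i v x - mean i v))\<^sup>2 \<partial>D i) \<le> \<sigma>\<^sup>2 * (1 + (norm (v - z))\<^sup>2)"
    and mu_pos: "\<mu> > 0"
    and mean_zero: "(\<Sum>i=1..n. mean i z) = 0"
    and mean_monotone: "\<mu> * (norm (v - z))\<^sup>2 \<le> (v - z) \<bullet> ((1 / real n) *\<^sub>R (\<Sum>i=1..n. mean i v))"
    and delay_le: "i \<in> {1..n} \<Longrightarrow> \<tau> i t \<le> t"
    and delay_ge: "i \<in> {1..n} \<Longrightarrow> t - T \<le> \<tau> i t"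
    and sample_measurable: "i \<in> {1..n} \<Longrightarrow> \<xi> i t \<in> M \<rightarrow>\<^sub>M D i"
    and sample_distr: "i \<in> {1..n} \<Longrightarrow> distr M (D i) (\<xi> i t) = D i"
    and sample_indep: "indep_vars (\<lambda>(i, t). D i) (\<lambda>(i, t). \<xi> i t) ({1..n} \<times> UNIV)"
    and w_0: "\<omega> \<in> space M \<Longrightarrow> w 0 \<omega> = w0"
    and w_Suc: "\<omega> \<in> space M \<Longrightarrow> w (Suc t) \<omega> =
      w t \<omega> - \<eta> t *\<^sub>R ((1 / real n) *\<^sub>R (\<Sum>i=1..n. G i (w (\<tau> i t) \<omega>) (\<xi> i (\<tau> i t) \<omega>)))"
begin

definition err :: "nat \<Rightarrow> 's \<Rightarrow> 'a" where
  "err t \<omega> = w t \<omega> - z"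

definition mse :: "nat \<Rightarrow> real" where
  "mse t = expectation (\<lambda>\<omega>. (norm (err t \<omega>))\<^sup>2)"

definition dir :: "nat \<Rightarrow> 's \<Rightarrow> 'a" where
  "dir t \<omega> = (1 / real n) *\<^sub>R (\<Sum>i=1..n. G i (w (\<tau> i t) \<omega>) (\<xi> i (\<tau> i t) \<omega>))"

text \<open>Indexed by the time \<open>s\<close> of the draw, not by the iteration that uses it: a
  stale gradient keeps its noise.\<close>

definition noise :: "nat \<Rightarrow> nat \<Rightarrow> 's \<Rightarrow> 'a" where
  "noise i s \<omega> = G i (w s \<omega>) (\<xi> i s \<omega>) - mean i (w s \<omega>)"

definition avg_noise :: "nat \<Rightarrow> 's \<Rightarrow> 'a" where
  "avg_noise t \<omega> = (1 / real n) *\<^sub>R (\<Sum>i=1..n. noise i (\<tau> i t) \<omega>)"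

text \<open>Indexed by a set of worker-time pairs rather than by a time, so that a single sample can
  be added to a past; comparing two noises drawn at the same time relies on this.\<close>

abbreviation history :: "(nat \<times> nat) set \<Rightarrow> 's measure" where
  "history J \<equiv> generated_by (\<lambda>(i, t). D i) (\<lambda>(i, t). \<xi> i t) J"

lemma err_Suc: "\<omega> \<in> space M \<Longrightarrow> err (Suc t) \<omega> = err t \<omega> - \<eta> t *\<^sub>R dir t \<omega>"
  by (simp add: err_def dir_def w_Suc)

lemma mse_nonneg: "0 \<le> mse t"
  by (simp add: mse_def)

section \<open>Regularity of the mean gradients and measurability of the iterates\<close>

lemma mean_lipschitz:
  assumes i: "i \<in> {1..n}"
  shows "norm (mean i u - mean i v) \<le> L * norm (u - v)"
proof -
  interpret D: prob_space "D i" using prob_D i .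
  have "norm (mean i u - mean i v) = norm (\<integral>x. G i u x - G i v x \<partial>D i)"
    using G_integrable[OF i] by (simp add: G_mean[OF i])
  also have "\<dots> \<le> (\<integral>x. norm (G i u x - G i v x) \<partial>D i)"
    by (rule integral_norm_bound)
  also have "\<dots> \<le> (\<integral>x. L * norm (u - v) \<partial>D i)"
  proof (rule integral_mono)
    show "integrable (D i) (\<lambda>x. norm (G i u x - G i v x))" using G_integrable[OF i] by auto
    show "norm (G i u x - G i v x) \<le> L * norm (u - v)" if "x \<in> space (D i)" for x
      using lipschitz_onD[OF G_lipschitz[OF i that], of u v] by (simp add: dist_norm)
  qed auto
  finally show ?thesis by (simp add: D.prob_space)
qed

lemma L_nonneg: "0 \<le> L"
proof -
  have one: "1 \<in> {1..n}" using n_pos by simp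
  interpret D: prob_space "D 1" using prob_D one .
  obtain x where "x \<in> space (D 1)" using D.not_empty by blast
  from G_lipschitz[OF one this] show ?thesis by (rule lipschitz_on_nonneg)
qed

lemma mean_measurable[measurable]:
  assumes i: "i \<in> {1..n}"
  shows "mean i \<in> borel_measurable borel"
proof -
  have "L-lipschitz_on UNIV (mean i)"
    using mean_lipschitz[OF i] L_nonneg by (intro lipschitz_onI) (auto simp: dist_norm)
  then show ?thesis
    by (intro borel_measurable_continuous_onI lipschitz_on_continuous_on)
qed

lemma G_measurable:
  assumes i: "i \<in> {1..n}" and [measurable]: "v \<in> borel_measurable N" "x \<in> N \<rightarrow>\<^sub>M D i"
  shows "(\<lambda>\<omega>. G i (v \<omega>) (x \<omega>)) \<in> borel_measurable N"
proof -
  have "(\<lambda>(v, x). G i v x) \<in> borel_measurable (borel \<Otimes>\<^sub>M D i)"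
    using G_integrable[OF i] lipschitz_on_continuous_on[OF G_lipschitz[OF i]]
    by (intro borel_measurable_Caratheodory) auto
  from measurable_compose[OF measurable_Pair[OF assms(2,3)] this] show ?thesis by simp
qed

text \<open>The iterate \<open>w s\<close> is built from samples drawn strictly before
  \<open>s\<close>. The space \<open>N\<close> is left general so that one induction covers both
  \<open>M\<close> and the histories.\<close>

lemma w_measurable:
  assumes "space N = space M" and "\<And>j r. j \<in> {1..n} \<Longrightarrow> r < s \<Longrightarrow> \<xi> j r \<in> N \<rightarrow>\<^sub>M D j"
  shows "w s \<in> borel_measurable N"
  using assms(2)
proof (induction s rule: less_induct)
  case (less s)
  show ?case
  proof (cases s)
    case 0
    then have "w s \<in> borel_measurable N \<longleftrightarrow> (\<lambda>_. w0) \<in> borel_measurable N"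
      using w_0 assms(1) by (intro measurable_cong) auto
    then show ?thesis by simp
  next
    case (Suc t)
    let ?r = "\<lambda>\<omega>. w t \<omega> - \<eta> t *\<^sub>R ((1 / real n) *\<^sub>R (\<Sum>i=1..n. G i (w (\<tau> i t) \<omega>) (\<xi> i (\<tau> i t) \<omega>)))"
    have IH: "w r \<in> borel_measurable N" if "r \<le> t" for r
      using that Suc less by auto
    \<comment> \<open>Since \<open>\<tau> i t \<le> t < s\<close>, the iterate is covered by
      induction and the sample by assumption.\<close>
    have "(\<lambda>\<omega>. G i (w (\<tau> i t) \<omega>) (\<xi> i (\<tau> i t) \<omega>)) \<in> borel_measurable N" if "i \<in> {1..n}" for i
      using that delay_le[OF that, of t] Suc
      by (intro G_measurable IH less.prems) auto
    then have "?r \<in> borel_measurable N" using IH by measurable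
    moreover have "w s \<in> borel_measurable N \<longleftrightarrow> ?r \<in> borel_measurable N"
      unfolding Suc using assms(1) by (intro measurable_cong w_Suc) auto
    ultimately show ?thesis by simp
  qed
qed

lemma sample_measurable_history:
  assumes J: "J \<subseteq> {1..n} \<times> UNIV" and "(i, s) \<in> J"
  shows "\<xi> i s \<in> history J \<rightarrow>\<^sub>M D i"
proof -
  have "(case (i, s) of (i, t) \<Rightarrow> \<xi> i t) \<in> history J \<rightarrow>\<^sub>M (case (i, s) of (i, t) \<Rightarrow> D i)"
    using assms sample_measurable by (intro measurable_generated_by) (auto split: prod.splits)
  then show ?thesis by simp
qed

lemma w_measurable_history:
  assumes "J \<subseteq> {1..n} \<times> UNIV" "{1..n} \<times> {..<s} \<subseteq> J"
  shows "w s \<in> borel_measurable (history J)"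
  using assms by (intro w_measurable sample_measurable_history) auto

lemma noise_measurable_history:
  assumes "J \<subseteq> {1..n} \<times> UNIV" "{1..n} \<times> {..<s} \<subseteq> J" "(i, s) \<in> J"
  shows "noise i s \<in> borel_measurable (history J)"
proof -
  have i: "i \<in> {1..n}" using assms by auto
  note [measurable] = w_measurable_history[OF assms(1,2)] mean_measurable[OF i]
  have [measurable]: "(\<lambda>\<omega>. G i (w s \<omega>) (\<xi> i s \<omega>)) \<in> borel_measurable (history J)"
    using assms by (intro G_measurable i w_measurable_history sample_measurable_history)
  show ?thesis unfolding noise_def[abs_def] by measurable
qed

lemma noise_measurable:
  assumes i: "i \<in> {1..n}"
  shows "noise i s \<in> borel_measurable M"
proof -
  note [measurable] = mean_measurable[OF i]
  have w[measurable]: "w s \<in> borel_measurable M" using w_measurable sample_measurable by blast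
  have [measurable]: "(\<lambda>\<omega>. G i (w s \<omega>) (\<xi> i s \<omega>)) \<in> borel_measurable M"
    by (intro G_measurable i w sample_measurable)
  show ?thesis unfolding noise_def[abs_def] by measurable
qed

section \<open>Fresh samples against the past\<close>

lemma sample_indep_history:
  assumes i: "i \<in> {1..n}" and J: "J \<subseteq> {1..n} \<times> UNIV" "(i, s) \<notin> J"
  shows "(\<lambda>\<omega>. \<omega>) \<in> M \<rightarrow>\<^sub>M history J"
    and "distr M (D i) (\<xi> i s) \<Otimes>\<^sub>M distr M (history J) (\<lambda>\<omega>. \<omega>)
      = distr M (D i \<Otimes>\<^sub>M history J) (\<lambda>\<omega>. (\<xi> i s \<omega>, \<omega>))"
  using distr_pair_generated_by[OF sample_indep J(1), of "(i, s)"] i J(2) by auto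

lemma G_history_measurable:
  assumes i: "i \<in> {1..n}" and J: "J \<subseteq> {1..n} \<times> UNIV" "{1..n} \<times> {..<s} \<subseteq> J"
  shows "(\<lambda>p. G i (w s (snd p)) (fst p) - mean i (w s (snd p))) \<in> borel_measurable (D i \<Otimes>\<^sub>M history J)"
proof -
  note [measurable] = w_measurable_history[OF J] mean_measurable[OF i]
  have [measurable]: "(\<lambda>p. G i (w s (snd p)) (fst p)) \<in> borel_measurable (D i \<Otimes>\<^sub>M history J)"
    by (intro G_measurable i) measurable
  show ?thesis by measurable
qed

text \<open>With everything in \<open>history J\<close> frozen, including \<open>w s\<close>, the
  sample \<open>\<xi> i s\<close> still has law \<open>D i\<close>, so the noise integrates to
  \<open>mean i (w s) - mean i (w s)\<close>. The set \<open>J\<close> may reach beyond the times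
  before \<open>s\<close> as long as it omits \<open>(i, s)\<close>.\<close>

lemma noise_orthogonal:
  assumes i: "i \<in> {1..n}" and J: "J \<subseteq> {1..n} \<times> UNIV" "{1..n} \<times> {..<s} \<subseteq> J" "(i, s) \<notin> J"
    and Y: "Y \<in> borel_measurable (history J)"
    and int: "integrable M (\<lambda>\<omega>. noise i s \<omega> \<bullet> Y \<omega>)"
  shows "expectation (\<lambda>\<omega>. noise i s \<omega> \<bullet> Y \<omega>) = 0"
proof -
  note [measurable] = Y G_history_measurable[OF i J(1,2)]
  interpret D: prob_space "D i" using prob_D i .
  let ?\<Psi> = "\<lambda>p. (G i (w s (snd p)) (fst p) - mean i (w s (snd p))) \<bullet> Y (snd p)"
  have "expectation (\<lambda>\<omega>. ?\<Psi> (\<xi> i s \<omega>, \<omega>)) = expectation (\<lambda>\<omega>. \<integral>x. ?\<Psi> (x, \<omega>) \<partial>distr M (D i) (\<xi> i s))"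
  proof (rule expectation_independent_pair[OF sample_measurable[OF i] sample_indep_history[OF i J(1,3)]])
    show "?\<Psi> \<in> borel_measurable (D i \<Otimes>\<^sub>M history J)" by measurable
    show "integrable M (\<lambda>\<omega>. ?\<Psi> (\<xi> i s \<omega>, \<omega>))" using int by (simp add: noise_def)
  qed
  also have "\<dots> = expectation (\<lambda>\<omega>. 0)"
    using G_integrable[OF i]
    by (simp add: sample_distr[OF i] G_mean[OF i] D.prob_space)
  finally show ?thesis by (simp add: noise_def)
qed

lemma noise_second_moment:
  assumes i: "i \<in> {1..n}" and err: "square_integrable M (err s)"
  shows "square_integrable M (noise i s)"
    and "expectation (\<lambda>\<omega>. (norm (noise i s \<omega>))\<^sup>2) \<le> \<sigma>\<^sup>2 * (1 + mse s)"
proof -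
  let ?J = "{1..n} \<times> {..<s}"
  have J: "?J \<subseteq> {1..n} \<times> UNIV" "(i, s) \<notin> ?J" by auto
  note [measurable] = G_history_measurable[OF i J(1) order_refl] noise_measurable[OF i]
  let ?\<Phi> = "\<lambda>p. ennreal ((norm (G i (w s (snd p)) (fst p) - mean i (w s (snd p))))\<^sup>2)"
  have int: "integrable M (\<lambda>\<omega>. \<sigma>\<^sup>2 * (1 + (norm (err s \<omega>))\<^sup>2))"
    using square_integrable_norm_power2[OF err] by auto
  have "(\<integral>\<^sup>+\<omega>. (norm (noise i s \<omega>))\<^sup>2 \<partial>M) = (\<integral>\<^sup>+\<omega>. ?\<Phi> (\<xi> i s \<omega>, \<omega>) \<partial>M)"
    by (simp add: noise_def)
  also have "\<dots> = (\<integral>\<^sup>+\<omega>. (\<integral>\<^sup>+x. ?\<Phi> (x, \<omega>) \<partial>distr M (D i) (\<xi> i s)) \<partial>M)"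
    by (rule nn_integral_independent_pair[OF sample_measurable[OF i] sample_indep_history[OF i J]])
      measurable
  also have "\<dots> \<le> (\<integral>\<^sup>+\<omega>. ennreal (\<sigma>\<^sup>2 * (1 + (norm (err s \<omega>))\<^sup>2)) \<partial>M)"
  proof (rule nn_integral_mono)
    fix \<omega>
    have "(\<integral>\<^sup>+x. ?\<Phi> (x, \<omega>) \<partial>D i) = ennreal (\<integral>x. (norm (G i (w s \<omega>) x - mean i (w s \<omega>)))\<^sup>2 \<partial>D i)"
      by (simp add: nn_integral_eq_integral G_variance_integrable[OF i])
    also have "\<dots> \<le> ennreal (\<sigma>\<^sup>2 * (1 + (norm (err s \<omega>))\<^sup>2))"
      unfolding err_def by (intro ennreal_leI G_variance i)
    finally show "(\<integral>\<^sup>+x. ?\<Phi> (x, \<omega>) \<partial>distr M (D i) (\<xi> i s)) \<le> ennreal (\<sigma>\<^sup>2 * (1 + (norm (err s \<omega>))\<^sup>2))"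
      by (simp add: sample_distr[OF i])
  qed
  also have "\<dots> = ennreal (expectation (\<lambda>\<omega>. \<sigma>\<^sup>2 * (1 + (norm (err s \<omega>))\<^sup>2)))"
    by (rule nn_integral_eq_integral[OF int]) simp
  also have "expectation (\<lambda>\<omega>. \<sigma>\<^sup>2 * (1 + (norm (err s \<omega>))\<^sup>2)) = \<sigma>\<^sup>2 * (1 + mse s)"
    using square_integrable_norm_power2[OF err] by (simp add: mse_def prob_space)
  finally have le: "(\<integral>\<^sup>+\<omega>. (norm (noise i s \<omega>))\<^sup>2 \<partial>M) \<le> ennreal (\<sigma>\<^sup>2 * (1 + mse s))" .
  then have sq: "integrable M (\<lambda>\<omega>. (norm (noise i s \<omega>))\<^sup>2)"
    by (intro integrableI_nonneg) (auto simp: less_top[symmetric] top_unique)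
  then show "square_integrable M (noise i s)"
    by (simp add: square_integrable_def noise_measurable[OF i])
  show "expectation (\<lambda>\<omega>. (norm (noise i s \<omega>))\<^sup>2) \<le> \<sigma>\<^sup>2 * (1 + mse s)"
    using le mse_nonneg[of s] by (simp add: nn_integral_eq_integral[OF sq])
qed

text \<open>Subtracting the \<open>mean i z\<close> is free since they sum to zero; afterwards the
  noiseless part is controlled by the errors at the stale iterates.\<close>

lemma dir_eq: "dir t \<omega> = avg_noise t \<omega> + (1 / real n) *\<^sub>R (\<Sum>i=1..n. mean i (w (\<tau> i t) \<omega>) - mean i z)"
  by (simp add: dir_def avg_noise_def noise_def sum_subtractf mean_zero scaleR_diff_right del: One_nat_def)

text \<open>Jensen's inequality for the squared norm of an average.\<close>

lemma norm_avg_le: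
  fixes u :: "nat \<Rightarrow> 'a"
  assumes "\<And>i. i \<in> {1..n} \<Longrightarrow> (norm (u i))\<^sup>2 \<le> b i"
  shows "(norm ((1 / real n) *\<^sub>R (\<Sum>i=1..n. u i)))\<^sup>2 \<le> (1 / real n) * (\<Sum>i=1..n. b i)"
proof -
  have "(norm (\<Sum>i=1..n. u i))\<^sup>2 \<le> real n * (\<Sum>i=1..n. (norm (u i))\<^sup>2)"
    using norm_sum_power2_le[of u "{1..n}"] by simp
  also have "\<dots> \<le> real n * (\<Sum>i=1..n. b i)"
    using assms by (intro mult_left_mono sum_mono) auto
  finally show ?thesis
    using n_pos by (simp add: power_mult_distrib power_divide divide_simps power2_eq_square mult.commute)
qed

lemma mean_drift:
  assumes "i \<in> {1..n}"
  shows "(norm (mean i u - mean i v))\<^sup>2 \<le> L\<^sup>2 * (norm (u - v))\<^sup>2"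
  using power_mono[OF mean_lipschitz[OF assms, of u v], of 2] by (simp add: power_mult_distrib)

text \<open>The two claims depend on each other: \<open>dir t\<close> needs the errors up to time
  \<open>t\<close>, and \<open>err (Suc t)\<close> needs \<open>dir t\<close>. Hence the claim on
  \<open>dir\<close> is first shown conditionally, and a strong induction for \<open>err\<close>
  closes the loop.\<close>

lemma
  shows square_integrable_err: "square_integrable M (err t)"
    and square_integrable_dir: "square_integrable M (dir t)"
proof -
  have dir: "square_integrable M (dir t)" if err: "\<And>r. r \<le> t \<Longrightarrow> square_integrable M (err r)" for t
    unfolding dir_eq[abs_def] avg_noise_def[abs_def]
  proof (intro square_integrable_add square_integrable_scaleR square_integrable_sum)
    fix i assume i: "i \<in> {1..n}"
    note [measurable] = mean_measurable[OF i]
    have e: "square_integrable M (err (\<tau> i t))" using err delay_le[OF i] .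
    show "square_integrable M (noise i (\<tau> i t))" by (rule noise_second_moment[OF i e])
    show "square_integrable M (\<lambda>\<omega>. mean i (w (\<tau> i t) \<omega>) - mean i z)"
    proof (rule square_integrable_bound[OF square_integrable_scaleR[OF e]])
      have [measurable]: "w (\<tau> i t) \<in> borel_measurable M" using w_measurable sample_measurable by blast
      show "(\<lambda>\<omega>. mean i (w (\<tau> i t) \<omega>) - mean i z) \<in> borel_measurable M" by measurable
      show "norm (mean i (w (\<tau> i t) \<omega>) - mean i z) \<le> norm (L *\<^sub>R err (\<tau> i t) \<omega>)" for \<omega>
        using mean_lipschitz[OF i] L_nonneg by (simp add: err_def)
    qed
  qed
  have err: "square_integrable M (err t)" for t
  proof (induction t rule: less_induct)
    case (less t)
    show ?case
    proof (cases t)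
      case 0
      have "square_integrable M (err 0) \<longleftrightarrow> square_integrable M (\<lambda>_. w0 - z)"
        using w_0 by (intro square_integrable_cong) (simp add: err_def)
      then show ?thesis using 0 square_integrable_const by simp
    next
      case (Suc r)
      have "square_integrable M (\<lambda>\<omega>. err r \<omega> - \<eta> r *\<^sub>R dir r \<omega>)"
        using less Suc by (intro square_integrable_diff square_integrable_scaleR dir) auto
      then show ?thesis unfolding Suc by (subst square_integrable_cong[OF err_Suc])
    qed
  qed
  then show "square_integrable M (err t)" .
  show "square_integrable M (dir t)" using dir err .
qed

section \<open>Second moments of noise and direction\<close>

lemma square_integrable_noise: "i \<in> {1..n} \<Longrightarrow> square_integrable M (noise i s)"
  by (rule noise_second_moment[OF _ square_integrable_err])

lemma square_integrable_avg_noise: "square_integrable M (avg_noise t)"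
  unfolding avg_noise_def[abs_def]
  by (intro square_integrable_scaleR square_integrable_sum square_integrable_noise)

text \<open>By symmetry \<open>r \<le> s\<close> may be assumed; then the noise drawn at
  \<open>s\<close> is orthogonal to the other one, which is determined without the sample
  \<open>(i, s)\<close>.\<close>

lemma noise_uncorrelated:
  assumes i: "i \<in> {1..n}" and j: "j \<in> {1..n}" and "i \<noteq> j"
  shows "expectation (\<lambda>\<omega>. noise i s \<omega> \<bullet> noise j r \<omega>) = 0"
proof -
  \<comment> \<open>The past of \<open>s\<close> alone misses the sample \<open>(j, r)\<close> when
    \<open>r = s\<close>, hence it is added; \<open>i \<noteq> j\<close> keeps \<open>(i, s)\<close>
    out.\<close>
  have le: "expectation (\<lambda>\<omega>. noise i s \<omega> \<bullet> noise j r \<omega>) = 0"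
    if "i \<in> {1..n}" "j \<in> {1..n}" "i \<noteq> j" "r \<le> s" for i j r s
    using that
    by (intro noise_orthogonal[where J = "{1..n} \<times> {..<s} \<union> {(j, r)}"] noise_measurable_history
        square_integrable_inner square_integrable_noise) auto
  show ?thesis
  proof (cases "r \<le> s")
    case True
    then show ?thesis using le assms by blast
  next
    case False
    then show ?thesis using le[of j i s r] assms by (simp add: inner_commute)
  qed
qed

text \<open>Each worker contributes one sample to the aggregate and different workers are
  uncorrelated, so the double sum collapses to \<open>n\<close> diagonal terms. Against the
  prefactor \<open>(1 / real n)\<^sup>2\<close> this leaves the gain \<open>1 / n\<close>.\<close>

lemma avg_noise_second_moment:
  assumes B: "\<And>r. t - T \<le> r \<Longrightarrow> r \<le> t \<Longrightarrow> mse r \<le> B"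
  shows "expectation (\<lambda>\<omega>. (norm (avg_noise t \<omega>))\<^sup>2) \<le> \<sigma>\<^sup>2 / real n * (1 + B)"
proof -
  let ?N = "\<lambda>i. noise i (\<tau> i t)"
  have int: "integrable M (\<lambda>\<omega>. ?N i \<omega> \<bullet> ?N j \<omega>)" if "i \<in> {1..n}" "j \<in> {1..n}" for i j
    using that by (intro square_integrable_inner square_integrable_noise)
  have "expectation (\<lambda>\<omega>. (norm (avg_noise t \<omega>))\<^sup>2)
      = expectation (\<lambda>\<omega>. (1 / real n)\<^sup>2 * (\<Sum>i=1..n. \<Sum>j=1..n. ?N i \<omega> \<bullet> ?N j \<omega>))"
    unfolding avg_noise_def by (simp only: norm_scaleR power_mult_distrib power2_abs norm_sum_power2_eq)
  also have "\<dots> = (1 / real n)\<^sup>2 * (\<Sum>i=1..n. \<Sum>j=1..n. expectation (\<lambda>\<omega>. ?N i \<omega> \<bullet> ?N j \<omega>))"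
  proof -
    have "expectation (\<lambda>\<omega>. \<Sum>i=1..n. \<Sum>j=1..n. ?N i \<omega> \<bullet> ?N j \<omega>)
        = (\<Sum>i=1..n. expectation (\<lambda>\<omega>. \<Sum>j=1..n. ?N i \<omega> \<bullet> ?N j \<omega>))"
      by (intro Bochner_Integration.integral_sum Bochner_Integration.integrable_sum int)
    also have "\<dots> = (\<Sum>i=1..n. \<Sum>j=1..n. expectation (\<lambda>\<omega>. ?N i \<omega> \<bullet> ?N j \<omega>))"
      by (intro sum.cong Bochner_Integration.integral_sum int refl)
    finally show ?thesis by simp
  qed
  also have "(\<Sum>i=1..n. \<Sum>j=1..n. expectation (\<lambda>\<omega>. ?N i \<omega> \<bullet> ?N j \<omega>))
      = (\<Sum>i=1..n. \<Sum>j=1..n. if i = j then expectation (\<lambda>\<omega>. (norm (?N i \<omega>))\<^sup>2) else 0)"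
    by (intro sum.cong refl) (auto simp: noise_uncorrelated power2_norm_eq_inner)
  also have "\<dots> = (\<Sum>i=1..n. expectation (\<lambda>\<omega>. (norm (?N i \<omega>))\<^sup>2))"
    by (intro sum.cong refl) (simp add: sum.delta)
  also have "\<dots> \<le> (\<Sum>i=1..n. \<sigma>\<^sup>2 * (1 + B))"
  proof (rule sum_mono)
    fix i assume i: "i \<in> {1..n}"
    have "expectation (\<lambda>\<omega>. (norm (?N i \<omega>))\<^sup>2) \<le> \<sigma>\<^sup>2 * (1 + mse (\<tau> i t))"
      by (rule noise_second_moment[OF i square_integrable_err])
    also have "\<dots> \<le> \<sigma>\<^sup>2 * (1 + B)"
      using B delay_le[OF i] delay_ge[OF i] by (intro mult_left_mono) auto
    finally show "expectation (\<lambda>\<omega>. (norm (?N i \<omega>))\<^sup>2) \<le> \<sigma>\<^sup>2 * (1 + B)" .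
  qed
  finally show ?thesis
    using n_pos by (simp add: power2_eq_square divide_simps)
qed

text \<open>All samples entering \<open>avg_noise t\<close> are drawn at time \<open>t - T\<close> or later.\<close>

lemma avg_noise_err_orthogonal: "expectation (\<lambda>\<omega>. avg_noise t \<omega> \<bullet> err (t - T) \<omega>) = 0"
proof -
  have "expectation (\<lambda>\<omega>. noise i (\<tau> i t) \<omega> \<bullet> err (t - T) \<omega>) = 0" if i: "i \<in> {1..n}" for i
  proof (rule noise_orthogonal[OF i, of "{1..n} \<times> {..<\<tau> i t}"])
    have [measurable]: "w (t - T) \<in> borel_measurable (history ({1..n} \<times> {..<\<tau> i t}))"
      using delay_ge[OF i, of t] by (intro w_measurable_history) auto
    show "err (t - T) \<in> borel_measurable (history ({1..n} \<times> {..<\<tau> i t}))"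
      unfolding err_def[abs_def] by measurable
    show "integrable M (\<lambda>\<omega>. noise i (\<tau> i t) \<omega> \<bullet> err (t - T) \<omega>)"
      by (intro square_integrable_inner square_integrable_noise square_integrable_err i)
  qed auto
  then show ?thesis
    by (simp add: avg_noise_def inner_sum_left Bochner_Integration.integral_sum
        square_integrable_inner square_integrable_noise square_integrable_err)
qed

text \<open>By \<open>dir_eq\<close> the direction is noise plus a part bounded through
  \<open>L\<close> by the stale errors; the factors 2 stem from squaring a sum of two
  vectors.\<close>

lemma dir_second_moment:
  assumes B: "\<And>r. t - T \<le> r \<Longrightarrow> r \<le> t \<Longrightarrow> mse r \<le> B"
  shows "expectation (\<lambda>\<omega>. (norm (dir t \<omega>))\<^sup>2) \<le> 2 * (\<sigma>\<^sup>2 / real n * (1 + B)) + 2 * L\<^sup>2 * B"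
proof -
  note int = square_integrable_norm_power2[OF square_integrable_err]
    square_integrable_norm_power2[OF square_integrable_avg_noise]
  have "expectation (\<lambda>\<omega>. (norm (dir t \<omega>))\<^sup>2)
      \<le> expectation (\<lambda>\<omega>. 2 * (norm (avg_noise t \<omega>))\<^sup>2
        + 2 * ((1 / real n) * (\<Sum>i=1..n. L\<^sup>2 * (norm (err (\<tau> i t) \<omega>))\<^sup>2)))"
  proof (rule integral_mono)
    show "integrable M (\<lambda>\<omega>. (norm (dir t \<omega>))\<^sup>2)"
      by (rule square_integrable_norm_power2[OF square_integrable_dir])
    fix \<omega>
    show "(norm (dir t \<omega>))\<^sup>2 \<le> 2 * (norm (avg_noise t \<omega>))\<^sup>2
        + 2 * ((1 / real n) * (\<Sum>i=1..n. L\<^sup>2 * (norm (err (\<tau> i t) \<omega>))\<^sup>2))"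
      unfolding dir_eq err_def
      by (intro order_trans[OF norm_add_power2_le] add_mono mult_left_mono norm_avg_le mean_drift) auto
  qed (use int in auto)
  also have "\<dots> = 2 * expectation (\<lambda>\<omega>. (norm (avg_noise t \<omega>))\<^sup>2)
      + 2 * ((1 / real n) * (\<Sum>i=1..n. L\<^sup>2 * mse (\<tau> i t)))"
    using int by (simp add: mse_def Bochner_Integration.integral_sum)
  also have "\<dots> \<le> 2 * (\<sigma>\<^sup>2 / real n * (1 + B)) + 2 * ((1 / real n) * (\<Sum>i=1..n. L\<^sup>2 * B))"
    using B delay_le delay_ge
    by (intro add_mono mult_left_mono sum_mono avg_noise_second_moment) auto
  also have "\<dots> = 2 * (\<sigma>\<^sup>2 / real n * (1 + B)) + 2 * L\<^sup>2 * B"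
    using n_pos by simp
  finally show ?thesis .
qed

section \<open>The error after one step\<close>

lemma err_diff:
  assumes "\<omega> \<in> space M" "r \<le> t"
  shows "err t \<omega> - err r \<omega> = - (\<Sum>k=r..<t. \<eta> k *\<^sub>R dir k \<omega>)"
  using assms(2) by (induction t rule: dec_induct) (simp_all add: err_Suc assms(1))

text \<open>The inequality is pathwise, so that expectations are taken only once. Monotonicity of
  the mean gradient contributes \<open>- 2 * \<mu>\<close>, of which Young's inequality gives back
  one \<open>\<mu>\<close> to pay for the drift. The last term is kept exact because its expectation
  vanishes.\<close>

lemma err_Suc_norm_power2_le:
  assumes \<omega>: "\<omega> \<in> space M" and eta: "0 < \<eta> t" "\<And>k. t - T \<le> k \<Longrightarrow> k < t \<Longrightarrow> 0 \<le> \<eta> k \<and> \<eta> k \<le> a"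
  shows "(norm (err (Suc t) \<omega>))\<^sup>2 \<le> (1 - \<mu> * \<eta> t) * (norm (err t \<omega>))\<^sup>2
      + \<eta> t / \<mu> * (L\<^sup>2 * (real T * a\<^sup>2 * (\<Sum>k=t-T..<t. (norm (dir k \<omega>))\<^sup>2)))
      + \<eta> t * (a * (\<Sum>k=t-T..<t. (norm (avg_noise t \<omega>))\<^sup>2 + (norm (dir k \<omega>))\<^sup>2))
      + (\<eta> t)\<^sup>2 * (norm (dir t \<omega>))\<^sup>2
      - 2 * \<eta> t * (avg_noise t \<omega> \<bullet> err (t - T) \<omega>)"
proof -
  let ?e = "err t \<omega>" and ?h = "\<lambda>k. dir k \<omega>" and ?\<epsilon> = "avg_noise t \<omega>"
  define S where "S = real T * a\<^sup>2 * (\<Sum>k=t-T..<t. (norm (?h k))\<^sup>2)"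
  \<comment> \<open>Here \<open>b\<close> is the drift due to stale iterates and \<open>g\<close>
    the mean gradient at the current iterate.\<close>
  define b where "b = (1 / real n) *\<^sub>R (\<Sum>i=1..n. mean i (w (\<tau> i t) \<omega>) - mean i (w t \<omega>))"
  define g where "g = (1 / real n) *\<^sub>R (\<Sum>i=1..n. mean i (w t \<omega>))"
  have h: "?h t = ?\<epsilon> + b + g"
    by (simp add: dir_def avg_noise_def noise_def b_def g_def sum_subtractf scaleR_diff_right)
  \<comment> \<open>At most \<open>T\<close> steps separate the two errors, and each step size is at
    most \<open>a\<close>.\<close>
  have drift: "(norm (err r \<omega> - err t \<omega>))\<^sup>2 \<le> S" if r: "t - T \<le> r" "r \<le> t" for r
  proof -
    have "(norm (err r \<omega> - err t \<omega>))\<^sup>2 = (norm (\<Sum>k=r..<t. \<eta> k *\<^sub>R ?h k))\<^sup>2"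
      using err_diff[OF \<omega> r(2)] by (metis norm_minus_cancel norm_minus_commute)
    also have "\<dots> \<le> real (card {r..<t}) * (\<Sum>k=r..<t. (norm (\<eta> k *\<^sub>R ?h k))\<^sup>2)"
      by (rule norm_sum_power2_le)
    also have "\<dots> \<le> real T * (\<Sum>k=r..<t. (norm (\<eta> k *\<^sub>R ?h k))\<^sup>2)"
      using r by (intro mult_right_mono sum_nonneg) auto
    also have "\<dots> \<le> real T * (\<Sum>k=r..<t. a\<^sup>2 * (norm (?h k))\<^sup>2)"
      using r eta(2) by (intro mult_left_mono sum_mono)
        (auto simp: power_mult_distrib intro!: mult_right_mono power_mono)
    also have "\<dots> \<le> real T * (\<Sum>k=t-T..<t. a\<^sup>2 * (norm (?h k))\<^sup>2)"
      using r by (intro mult_left_mono sum_mono2) auto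
    finally show ?thesis by (simp add: S_def sum_distrib_left mult.assoc)
  qed
  have "(norm b)\<^sup>2 \<le> (1 / real n) * (\<Sum>i=1..n. L\<^sup>2 * S)"
    unfolding b_def
  proof (rule norm_avg_le)
    fix i assume i: "i \<in> {1..n}"
    have "(norm (mean i (w (\<tau> i t) \<omega>) - mean i (w t \<omega>)))\<^sup>2 \<le> L\<^sup>2 * (norm (err (\<tau> i t) \<omega> - err t \<omega>))\<^sup>2"
      using mean_drift[OF i, of "w (\<tau> i t) \<omega>" "w t \<omega>"] by (simp add: err_def)
    also have "\<dots> \<le> L\<^sup>2 * S"
      using drift delay_le[OF i] delay_ge[OF i] by (intro mult_left_mono) auto
    finally show "(norm (mean i (w (\<tau> i t) \<omega>) - mean i (w t \<omega>)))\<^sup>2 \<le> L\<^sup>2 * S" .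
  qed
  then have b: "(norm b)\<^sup>2 \<le> L\<^sup>2 * S" using n_pos by simp
  \<comment> \<open>Young's inequality with weight \<open>\<mu>\<close>, by expanding a
    square.\<close>
  have eb: "- 2 * (?e \<bullet> b) \<le> \<mu> * (norm ?e)\<^sup>2 + L\<^sup>2 * S / \<mu>"
  proof -
    have "0 \<le> (norm (\<mu> *\<^sub>R ?e + b))\<^sup>2" by simp
    also have "\<dots> = \<mu>\<^sup>2 * (norm ?e)\<^sup>2 + 2 * \<mu> * (?e \<bullet> b) + (norm b)\<^sup>2"
      by (simp add: power2_norm_eq_inner inner_add inner_commute power2_eq_square[of \<mu>])
    finally have "- 2 * (?e \<bullet> b) * \<mu> \<le> (\<mu> * (norm ?e)\<^sup>2) * \<mu> + L\<^sup>2 * S"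
      using b by (simp add: power2_eq_square algebra_simps)
    then show ?thesis using mu_pos by (simp add: field_simps)
  qed
  have eg: "\<mu> * (norm ?e)\<^sup>2 \<le> ?e \<bullet> g"
    unfolding g_def err_def by (rule mean_monotone)
  \<comment> \<open>The current error is replaced by the one at time \<open>t - T\<close>; the
    difference is a sum of past steps, whose products with the noise are split by the
    arithmetic-geometric inequality.\<close>
  have noise: "- 2 * (?e \<bullet> ?\<epsilon>) \<le> a * (\<Sum>k=t-T..<t. (norm ?\<epsilon>)\<^sup>2 + (norm (?h k))\<^sup>2) - 2 * (?\<epsilon> \<bullet> err (t - T) \<omega>)"
  proof -
    have "- 2 * ((?e - err (t - T) \<omega>) \<bullet> ?\<epsilon>) = (\<Sum>k=t-T..<t. 2 * \<eta> k * (?h k \<bullet> ?\<epsilon>))"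
      by (simp add: err_diff[OF \<omega>] inner_sum_left sum_distrib_left sum_negf mult.assoc)
    also have "\<dots> \<le> (\<Sum>k=t-T..<t. a * ((norm ?\<epsilon>)\<^sup>2 + (norm (?h k))\<^sup>2))"
    proof (rule sum_mono)
      fix k assume k: "k \<in> {t-T..<t}"
      then have ek: "0 \<le> \<eta> k" "\<eta> k \<le> a" using eta(2) by auto
      have "2 * \<eta> k * (?h k \<bullet> ?\<epsilon>) = \<eta> k * (2 * (?h k \<bullet> ?\<epsilon>))" by simp
      also have "\<dots> \<le> \<eta> k * ((norm ?\<epsilon>)\<^sup>2 + (norm (?h k))\<^sup>2)"
        using abs_inner_le_half_sum_power2[of "?h k" ?\<epsilon>] ek(1)
        by (intro mult_left_mono) (auto simp: abs_le_iff)
      also have "\<dots> \<le> a * ((norm ?\<epsilon>)\<^sup>2 + (norm (?h k))\<^sup>2)"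
        using ek by (intro mult_right_mono) auto
      finally show "2 * \<eta> k * (?h k \<bullet> ?\<epsilon>) \<le> a * ((norm ?\<epsilon>)\<^sup>2 + (norm (?h k))\<^sup>2)" .
    qed
    finally show ?thesis
      by (simp add: sum_distrib_left inner_diff_left inner_diff_right inner_commute)
  qed
  \<comment> \<open>The inner products are generalised to real variables, which leaves plain linear
    arithmetic.\<close>
  have combine: "- 2 * (r + p + q) \<le> - A + B + C - 2 * d"
    if "- 2 * p \<le> A + B" "A \<le> q" "- 2 * r \<le> C - 2 * d" for p q r A B C d :: real
    using that by argo
  have "- 2 * (?e \<bullet> ?h t) \<le> - (\<mu> * (norm ?e)\<^sup>2) + L\<^sup>2 * S / \<mu>
      + a * (\<Sum>k=t-T..<t. (norm ?\<epsilon>)\<^sup>2 + (norm (?h k))\<^sup>2) - 2 * (?\<epsilon> \<bullet> err (t - T) \<omega>)"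
    unfolding h inner_add_right by (rule combine[OF eb eg noise])
  from mult_left_mono[OF this, of "\<eta> t"] eta(1)
  have "- 2 * \<eta> t * (?e \<bullet> ?h t) \<le> \<eta> t * (- (\<mu> * (norm ?e)\<^sup>2) + L\<^sup>2 * S / \<mu>
      + a * (\<Sum>k=t-T..<t. (norm ?\<epsilon>)\<^sup>2 + (norm (?h k))\<^sup>2) - 2 * (?\<epsilon> \<bullet> err (t - T) \<omega>))"
    by simp
  moreover have "(norm (err (Suc t) \<omega>))\<^sup>2
      = (norm ?e)\<^sup>2 - 2 * \<eta> t * (?e \<bullet> ?h t) + (\<eta> t)\<^sup>2 * (norm (?h t))\<^sup>2"
    by (simp add: err_Suc[OF \<omega>] power2_norm_eq_inner inner_diff inner_commute power2_eq_square[of "\<eta> t"])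
  ultimately show ?thesis
    unfolding S_def[symmetric] by (simp add: algebra_simps)
qed

text \<open>The window for \<open>B\<close> has length \<open>2 * T\<close> because the directions
  of the last \<open>T\<close> steps themselves use iterates up to \<open>T\<close> older.
  \<open>V\<close> and \<open>U\<close> bound the second moments of the averaged noise and of the
  direction.\<close>

lemma mse_Suc_le:
  assumes eta: "0 < \<eta> t" "\<And>k. t - T \<le> k \<Longrightarrow> k < t \<Longrightarrow> 0 \<le> \<eta> k \<and> \<eta> k \<le> a" and a: "0 \<le> a"
    and B: "\<And>r. t - 2 * T \<le> r \<Longrightarrow> r \<le> t \<Longrightarrow> mse r \<le> B"
    and V: "V = \<sigma>\<^sup>2 / real n * (1 + B)" and U: "U = 2 * V + 2 * L\<^sup>2 * B"
  shows "mse (Suc t) \<le> (1 - \<mu> * \<eta> t) * mse t + \<eta> t / \<mu> * (L\<^sup>2 * (real T * a\<^sup>2 * (real T * U)))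
      + \<eta> t * (a * (real T * (V + U))) + (\<eta> t)\<^sup>2 * U"
proof -
  let ?E = "\<lambda>X. expectation (\<lambda>\<omega>. (norm (X \<omega> :: 'a))\<^sup>2)"
  note int = square_integrable_norm_power2[OF square_integrable_err]
    square_integrable_norm_power2[OF square_integrable_dir]
    square_integrable_norm_power2[OF square_integrable_avg_noise]
    square_integrable_inner[OF square_integrable_avg_noise square_integrable_err]
  have "0 \<le> B" using B[of t] mse_nonneg[of t] by simp
  then have V0: "0 \<le> V" and U0: "0 \<le> U" unfolding U V by auto
  have dir: "?E (dir k) \<le> U" if "t - T \<le> k" "k \<le> t" for k
    unfolding U V using that B by (intro dir_second_moment) auto
  have noise: "?E (avg_noise t) \<le> V"
    unfolding V using B by (intro avg_noise_second_moment) auto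
  \<comment> \<open>For \<open>t < T\<close> the sum has fewer than \<open>T\<close> terms, which is
    why \<open>C\<close> must be nonnegative.\<close>
  have sum_le: "(\<Sum>k=t-T..<t. c k) \<le> real T * C" if "\<And>k. t - T \<le> k \<Longrightarrow> k < t \<Longrightarrow> c k \<le> C" "0 \<le> C" for c C
  proof -
    have "(\<Sum>k=t-T..<t. c k) \<le> real (card {t-T..<t}) * C"
      using that(1) by (intro sum_bounded_above) auto
    also have "\<dots> \<le> real T * C" using that(2) by (intro mult_right_mono) auto
    finally show ?thesis .
  qed
  have "mse (Suc t) \<le> expectation (\<lambda>\<omega>. (1 - \<mu> * \<eta> t) * (norm (err t \<omega>))\<^sup>2
      + \<eta> t / \<mu> * (L\<^sup>2 * (real T * a\<^sup>2 * (\<Sum>k=t-T..<t. (norm (dir k \<omega>))\<^sup>2)))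
      + \<eta> t * (a * (\<Sum>k=t-T..<t. (norm (avg_noise t \<omega>))\<^sup>2 + (norm (dir k \<omega>))\<^sup>2))
      + (\<eta> t)\<^sup>2 * (norm (dir t \<omega>))\<^sup>2
      - 2 * \<eta> t * (avg_noise t \<omega> \<bullet> err (t - T) \<omega>))"
    unfolding mse_def
    by (rule integral_mono) (use int err_Suc_norm_power2_le[OF _ eta] in auto)
  also have "\<dots> = (1 - \<mu> * \<eta> t) * mse t
      + \<eta> t / \<mu> * (L\<^sup>2 * (real T * a\<^sup>2 * (\<Sum>k=t-T..<t. ?E (dir k))))
      + \<eta> t * (a * (\<Sum>k=t-T..<t. ?E (avg_noise t) + ?E (dir k)))
      + (\<eta> t)\<^sup>2 * ?E (dir t)"
    using int by (simp add: mse_def avg_noise_err_orthogonal)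
  also have "\<dots> \<le> (1 - \<mu> * \<eta> t) * mse t + \<eta> t / \<mu> * (L\<^sup>2 * (real T * a\<^sup>2 * (real T * U)))
      + \<eta> t * (a * (real T * (V + U))) + (\<eta> t)\<^sup>2 * U"
    using eta(1) a mu_pos dir noise U0 V0
    by (intro add_mono mult_left_mono sum_le order_refl) auto
  finally show ?thesis .
qed

text \<open>Monotonicity is tested at distance one from \<open>z\<close>, where the Lipschitz bound
  limits the averaged gradient to \<open>L\<close>.\<close>

lemma mu_le_L: "\<mu> \<le> L"
proof -
  obtain b :: 'a where b: "b \<in> Basis" using nonempty_Basis by blast
  let ?g = "(1 / real n) *\<^sub>R (\<Sum>i=1..n. mean i (z + b) - mean i z)"
  have "\<mu> \<le> b \<bullet> ?g"
    using mean_monotone[of "z + b"] b by (simp add: sum_subtractf mean_zero del: One_nat_def)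
  also have "\<dots> \<le> norm ?g" using norm_cauchy_schwarz[of b ?g] b by simp
  also have "\<dots> \<le> L"
  proof (rule power2_le_imp_le[OF _ L_nonneg])
    have "(norm ?g)\<^sup>2 \<le> (1 / real n) * (\<Sum>i=1..n. L\<^sup>2)"
      using mean_drift[of _ "z + b" z] b by (intro norm_avg_le) auto
    then show "(norm ?g)\<^sup>2 \<le> L\<^sup>2" using n_pos by simp
  qed
  finally show ?thesis .
qed

end

subsection \<open>The rate recursion\<close>

text \<open>In the application \<open>H\<close> is the claimed bound at the current time,
  \<open>s\<close> is \<open>\<sigma>\<^sup>2 / n\<close>, and the factors in
  \<open>2 * \<eta>\<close> and \<open>4 * H\<close> are the losses over the delay window. The drift
  term is cubic in \<open>\<eta>\<close>; one factor is traded through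
  \<open>\<eta> * T \<le> \<beta> / 2\<close>, so that all terms have order
  \<open>\<eta>\<^sup>2\<close>.\<close>

lemma variance_terms_le:
  fixes \<eta> s H L T \<mu> \<beta> \<rho> :: real
  assumes nonneg: "0 \<le> s" "0 \<le> H" "0 \<le> T" "0 < \<mu>" "0 \<le> \<beta>" "0 \<le> \<eta>"
    and \<eta>T: "\<eta> * T \<le> \<beta> / 2" and \<rho>: "1 + 2 * T + 5 * (L\<^sup>2 * \<beta> * T / \<mu>) \<le> \<rho>"
    and V: "V = s * (1 + 4 * H)" and U: "U = 2 * V + 2 * L\<^sup>2 * (4 * H)"
  shows "\<eta> / \<mu> * (L\<^sup>2 * (T * (2 * \<eta>)\<^sup>2 * (T * U))) + \<eta> * (2 * \<eta> * (T * (V + U))) + \<eta>\<^sup>2 * U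
    \<le> \<eta>\<^sup>2 * (4 * \<rho> * s + 8 * (20 * L\<^sup>2 + 2 * s) * \<rho> * H)"
proof -
  define l where "l = L\<^sup>2"
  define c where "c = l * \<beta> * T / \<mu>"
  have l: "0 \<le> l" by (simp add: l_def)
  then have c: "0 \<le> c" using nonneg by (simp add: c_def)
  have U0: "0 \<le> U" unfolding U V using nonneg by simp
  have "\<eta> / \<mu> * (L\<^sup>2 * (T * (2 * \<eta>)\<^sup>2 * (T * U))) = \<eta>\<^sup>2 * (4 * l * T / \<mu> * U * (\<eta> * T))"
    by (simp add: l_def power2_eq_square)
  also have "\<dots> \<le> \<eta>\<^sup>2 * (4 * l * T / \<mu> * U * (\<beta> / 2))"
    using nonneg l U0 by (intro mult_left_mono[OF mult_left_mono[OF \<eta>T]]) auto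
  also have "\<dots> = \<eta>\<^sup>2 * (2 * c * U)" by (simp add: c_def)
  finally have "\<eta> / \<mu> * (L\<^sup>2 * (T * (2 * \<eta>)\<^sup>2 * (T * U))) + \<eta> * (2 * \<eta> * (T * (V + U))) + \<eta>\<^sup>2 * U
      \<le> \<eta>\<^sup>2 * (2 * c * U + 2 * T * (V + U) + U)"
    by (simp add: power2_eq_square algebra_simps)
  also have "\<dots> \<le> \<eta>\<^sup>2 * (\<rho> * (4 * s + 8 * (20 * l + 2 * s) * H))"
  proof (intro mult_left_mono zero_le_power2)
    \<comment> \<open>The surplus of the larger side is written out; all its coefficients are
      nonnegative.\<close>
    have "(1 + 2 * T + 5 * c) * (4 * s + 8 * (20 * l + 2 * s) * H) = 2 * c * U + 2 * T * (V + U) + U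
        + (c * (16 * s + 64 * (s * H) + 784 * (l * H)) + T * (2 * s + 8 * (s * H) + 304 * (l * H))
          + 2 * s + 8 * (s * H) + 152 * (l * H))"
      unfolding U V l_def by algebra
    moreover have "0 \<le> c * (16 * s + 64 * (s * H) + 784 * (l * H))
        + T * (2 * s + 8 * (s * H) + 304 * (l * H)) + 2 * s + 8 * (s * H) + 152 * (l * H)"
      using nonneg l c by simp
    ultimately have "2 * c * U + 2 * T * (V + U) + U
        \<le> (1 + 2 * T + 5 * c) * (4 * s + 8 * (20 * l + 2 * s) * H)"
      by linarith
    also have "\<dots> \<le> \<rho> * (4 * s + 8 * (20 * l + 2 * s) * H)"
    proof (rule mult_right_mono)
      show "1 + 2 * T + 5 * c \<le> \<rho>" unfolding c_def l_def by (rule \<rho>)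
      show "0 \<le> 4 * s + 8 * (20 * l + 2 * s) * H" using nonneg l by simp
    qed
    finally show "2 * c * U + 2 * T * (V + U) + U \<le> \<rho> * (4 * s + 8 * (20 * l + 2 * s) * H)" .
  qed
  also have "\<rho> * (4 * s + 8 * (20 * l + 2 * s) * H) = 4 * \<rho> * s + 8 * (20 * l + 2 * s) * \<rho> * H"
    by (simp only: distrib_left mult.commute mult.left_commute mult.assoc)
  finally show ?thesis unfolding l_def .
qed

text \<open>In the application \<open>x\<close> is \<open>t + \<gamma>\<close>, \<open>P\<close> is
  \<open>\<mu> * \<beta>\<close>, \<open>R\<close> is \<open>\<beta>\<^sup>2 * \<rho>\<close> and
  \<open>K\<close> is \<open>C * R\<close>. The bound on \<open>K\<close> lets the variance
  proportional to \<open>H\<close> consume \<open>(P / 2 - 1) / x\<close> of the contraction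
  \<open>P / x\<close>, leaving \<open>(P / 2 + 1) / x\<close>.\<close>

lemma rate_recursion:
  fixes x P K R s \<delta>1 \<delta>2 H y :: real
  assumes x: "0 < x" and P: "4 < P" and K: "16 * K \<le> (P - 2) * x"
    and \<delta>1: "\<delta>1 = 32 * R / (P - 2) + 1" and nonneg: "0 \<le> R" "0 \<le> s" "0 \<le> \<delta>2"
    and H: "H = \<delta>1 * s / x + \<delta>2 / x\<^sup>2"
    and y: "y \<le> (1 - P / x) * H + (4 * R * s + 8 * K * H) / x\<^sup>2"
  shows "y \<le> \<delta>1 * s / (x + 1) + \<delta>2 / (x + 1)\<^sup>2"
proof -
  have \<delta>1_pos: "0 < \<delta>1" using P nonneg(1) by (simp add: \<delta>1 add_nonneg_pos)
  have "0 \<le> H" using \<delta>1_pos x nonneg by (simp add: H)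
  then have "16 * K * H \<le> (P - 2) * x * H" using K by (intro mult_right_mono)
  then have "8 * K * H / x\<^sup>2 \<le> (P - 2) * x * H / 2 / x\<^sup>2" by (intro divide_right_mono) auto
  also have "\<dots> = (P / 2 - 1) / x * H" using x by (simp add: field_simps power2_eq_square)
  finally have "y \<le> (1 - (P / 2 + 1) / x) * H + 4 * R * s / x\<^sup>2"
    using y x by (simp add: field_simps)
  also have "\<dots> = ((1 - (P / 2 + 1) / x) * (\<delta>1 * s / x) + 4 * R * s / x\<^sup>2)
      + (1 - (P / 2 + 1) / x) * (\<delta>2 / x\<^sup>2)"
    by (simp add: H algebra_simps)
  also have "\<dots> \<le> \<delta>1 * s / (x + 1) + \<delta>2 / (x + 1)\<^sup>2"
  proof (rule add_mono)
    \<comment> \<open>In the part of order \<open>1 / x\<close>, the share \<open>P / 2\<close>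
      absorbs the variance, as \<open>8 * R \<le> \<delta>1 * P\<close>, and the remaining 1 turns
      \<open>1 / x\<close> into \<open>1 / (x + 1)\<close>.\<close>
    have "32 * R \<le> \<delta>1 * (P - 2)" using P by (simp add: \<delta>1 distrib_right)
    also have "\<dots> \<le> \<delta>1 * (4 * P)" using \<delta>1_pos P by (intro mult_left_mono) auto
    finally have "8 * R \<le> \<delta>1 * P" by (simp add: mult.commute)
    then have "8 * R * s \<le> \<delta>1 * P * s" using nonneg by (intro mult_right_mono)
    then have "4 * R * s / x\<^sup>2 \<le> \<delta>1 * P * s / 2 / x\<^sup>2" using x by (intro divide_right_mono) auto
    moreover have "(1 - (P / 2 + 1) / x) * (\<delta>1 * s / x)
        = \<delta>1 * s * ((x - 1) / x\<^sup>2) - \<delta>1 * P * s / 2 / x\<^sup>2"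
      using x by (simp add: field_simps power2_eq_square)
    ultimately have "(1 - (P / 2 + 1) / x) * (\<delta>1 * s / x) + 4 * R * s / x\<^sup>2 \<le> \<delta>1 * s * ((x - 1) / x\<^sup>2)"
      by linarith
    also have "(x - 1) / x\<^sup>2 \<le> 1 / (x + 1)"
      using x by (simp add: divide_simps) (simp add: power2_eq_square algebra_simps)
    then have "\<delta>1 * s * ((x - 1) / x\<^sup>2) \<le> \<delta>1 * s * (1 / (x + 1))"
      using \<delta>1_pos nonneg by (intro mult_left_mono) auto
    finally show "(1 - (P / 2 + 1) / x) * (\<delta>1 * s / x) + 4 * R * s / x\<^sup>2 \<le> \<delta>1 * s / (x + 1)"
      by simp
    \<comment> \<open>In the part of order \<open>1 / x\<^sup>2\<close>, a contraction by
      \<open>2 / x\<close> already pays for passing from \<open>x\<close> to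
      \<open>x + 1\<close>.\<close>
    have "1 - (P / 2 + 1) / x \<le> 1 - 2 / x" using P x by (simp add: divide_right_mono)
    also have "\<dots> \<le> x\<^sup>2 / (x + 1)\<^sup>2"
      using x by (simp add: divide_simps) (simp add: power2_eq_square algebra_simps)
    finally have "(1 - (P / 2 + 1) / x) * (\<delta>2 / x\<^sup>2) \<le> x\<^sup>2 / (x + 1)\<^sup>2 * (\<delta>2 / x\<^sup>2)"
      using nonneg by (intro mult_right_mono) auto
    then show "(1 - (P / 2 + 1) / x) * (\<delta>2 / x\<^sup>2) \<le> \<delta>2 / (x + 1)\<^sup>2"
      using x by simp
  qed
  finally show ?thesis .
qed

lemma (in delayed_gradient_method) mse_rate:
  fixes \<beta> \<gamma> C \<rho> \<delta>1 \<delta>2 :: real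
  assumes eta: "\<And>t. \<eta> t = \<beta> / (real t + \<gamma>)"
    and C: "C = 20 * L\<^sup>2 + 2 * \<sigma>\<^sup>2 / real n"
    and \<rho>: "1 + 2 * real T + 5 * (L\<^sup>2 * \<beta> * real T / \<mu>) \<le> \<rho>"
    and \<beta>: "4 < \<mu> * \<beta>"
    and \<gamma>: "2 * real T + 16 * C * \<beta>\<^sup>2 / (\<mu> * \<beta> - 2) * \<rho> \<le> \<gamma>"
    and \<delta>1: "\<delta>1 = 32 * \<beta>\<^sup>2 * \<rho> / (\<mu> * \<beta> - 2) + 1"
    and \<delta>2: "\<delta>2 = \<gamma>\<^sup>2 * mse 0"
  shows "mse t \<le> \<delta>1 / (\<gamma> + real t) * (\<sigma>\<^sup>2 / real n) + \<delta>2 / (\<gamma> + real t)\<^sup>2"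
proof -
  define s where "s = \<sigma>\<^sup>2 / real n"
  define P where "P = \<mu> * \<beta>"
  define h where "h = (\<lambda>t::nat. \<delta>1 * s / (real t + \<gamma>) + \<delta>2 / (real t + \<gamma>)\<^sup>2)"
  have s: "0 \<le> s" by (simp add: s_def)
  have C': "C = 20 * L\<^sup>2 + 2 * s" by (simp add: C s_def)
  have P: "4 < P" using \<beta> by (simp add: P_def)
  have \<beta>0: "0 < \<beta>" using P mu_pos unfolding P_def by (smt (verit) zero_less_mult_pos)
  have "0 \<le> L\<^sup>2 * \<beta> * real T / \<mu>" using \<beta>0 mu_pos by simp
  then have \<rho>1: "1 + 2 * real T \<le> \<rho>" using \<rho> by linarith
  have \<rho>0: "1 \<le> \<rho>" using \<rho>1 by simp
  have \<delta>1_pos: "0 < \<delta>1" using P \<rho>0 unfolding \<delta>1 P_def[symmetric] by (simp add: add_nonneg_pos)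
  have \<delta>2_nonneg: "0 \<le> \<delta>2" using mse_nonneg by (simp add: \<delta>2)
  define Q where "Q = 16 * C * \<beta>\<^sup>2 / (P - 2)"
  \<comment> \<open>The product \<open>Q * \<rho>\<close> is the second summand in the lower bound
    on \<open>\<gamma>\<close>. Since \<open>C \<ge> L\<^sup>2 \<ge> \<mu>\<^sup>2\<close>, it
    dominates \<open>4 * P * \<rho>\<close>.\<close>
  have Q: "4 * P \<le> Q"
  proof -
    have "P\<^sup>2 \<le> (L * \<beta>)\<^sup>2"
      unfolding P_def using mu_le_L mu_pos \<beta>0 by (intro power_mono mult_right_mono) auto
    also have "\<dots> \<le> C * \<beta>\<^sup>2"
      unfolding C' power_mult_distrib using s by (intro mult_right_mono) auto
    finally have "16 * P\<^sup>2 \<le> 16 * C * \<beta>\<^sup>2" by simp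
    moreover have "4 * P * (P - 2) \<le> 16 * P\<^sup>2" using P by (simp add: power2_eq_square algebra_simps)
    ultimately show ?thesis unfolding Q_def using P by (simp add: le_divide_eq)
  qed
  have \<gamma>_Q: "2 * real T + Q * \<rho> \<le> \<gamma>" using \<gamma> by (simp add: Q_def P_def)
  have "4 * P * (1 + 2 * real T) \<le> Q * \<rho>"
    using Q \<rho>1 P by (intro mult_mono) auto
  moreover have "P + 2 * real T \<le> 4 * P * (1 + 2 * real T)"
  proof -
    have "2 * real T \<le> 4 * P * (2 * real T)" using P mult_right_mono[of 1 "4 * P" "2 * real T"] by simp
    then show ?thesis using P by (simp add: algebra_simps)
  qed
  \<comment> \<open>The summand \<open>P\<close> keeps the contraction factor
    \<open>1 - P / x\<close> nonnegative, and \<open>4 * real T\<close> ensures that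
    \<open>x\<close> at most halves over the window.\<close>
  ultimately have \<gamma>_ge: "P + 4 * real T \<le> \<gamma>" using \<gamma>_Q by linarith
  have K: "16 * (C * \<beta>\<^sup>2 * \<rho>) \<le> (P - 2) * x" if "\<gamma> \<le> x" for x
  proof -
    have "16 * (C * \<beta>\<^sup>2 * \<rho>) = (P - 2) * (Q * \<rho>)" using P by (simp add: Q_def)
    also have "\<dots> \<le> (P - 2) * x" using P \<gamma>_Q that by (intro mult_left_mono) auto
    finally show ?thesis .
  qed
  \<comment> \<open>Strong induction, since the one-step bound looks back over \<open>2 * T\<close>
    iterations.\<close>
  have "mse t \<le> h t" for t
  proof (induction t rule: less_induct)
    case (less t)
    show ?case
    proof (cases t)
      case 0
      \<comment> \<open>At time 0 the second summand of \<open>h\<close> is the initial error, by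
        the choice of \<open>\<delta>2\<close>.\<close>
      have "mse 0 = \<delta>2 / (real 0 + \<gamma>)\<^sup>2" using \<gamma>_ge P by (simp add: \<delta>2)
      then show ?thesis using 0 \<delta>1_pos s \<gamma>_ge P by (simp add: h_def)
    next
      case (Suc m)
      define x where "x = real m + \<gamma>"
      have x: "P + 4 * real T \<le> x" "\<gamma> \<le> x" using \<gamma>_ge by (auto simp: x_def)
      have x0: "0 < x" using x P by simp
      have eta_m: "\<eta> m = \<beta> / x" by (simp add: eta x_def)
      have x_half: "x / 2 \<le> real r + \<gamma>" if "m - 2 * T \<le> r" for r
      proof -
        have "real m \<le> real r + 2 * real T" using that by linarith
        then show ?thesis using x P by (simp add: x_def field_simps)
      qed
      have H0: "0 \<le> h m" using \<delta>1_pos \<delta>2_nonneg s x0 by (simp add: h_def x_def)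
      \<comment> \<open>Halving \<open>x\<close> doubles \<open>1 / x\<close> and quadruples
        \<open>1 / x\<^sup>2\<close>, whence the factor 4.\<close>
      have B: "mse r \<le> 4 * h m" if "m - 2 * T \<le> r" "r \<le> m" for r
      proof -
        have half: "x / 2 \<le> real r + \<gamma>" using x_half that by simp
        have "mse r \<le> h r" using less Suc that by simp
        also have "\<dots> \<le> \<delta>1 * s / (x / 2) + \<delta>2 / (x / 2)\<^sup>2"
          unfolding h_def using half x0 \<delta>1_pos \<delta>2_nonneg s
          by (intro add_mono divide_left_mono power_mono mult_pos_pos) auto
        also have "\<dots> = 2 * (\<delta>1 * s / x) + 4 * (\<delta>2 / x\<^sup>2)" by (simp add: power_divide mult_ac)
        also have "\<dots> \<le> 4 * (\<delta>1 * s / x) + 4 * (\<delta>2 / x\<^sup>2)"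
          using \<delta>1_pos \<delta>2_nonneg s x0 by (intro add_mono mult_right_mono) auto
        also have "\<dots> = 4 * h m" by (simp add: h_def x_def)
        finally show ?thesis .
      qed
      define V where "V = s * (1 + 4 * h m)"
      define U where "U = 2 * V + 2 * L\<^sup>2 * (4 * h m)"
      have "mse (Suc m) \<le> (1 - \<mu> * \<eta> m) * mse m
          + \<eta> m / \<mu> * (L\<^sup>2 * (real T * (2 * \<eta> m)\<^sup>2 * (real T * U)))
          + \<eta> m * (2 * \<eta> m * (real T * (V + U))) + (\<eta> m)\<^sup>2 * U"
      proof (rule mse_Suc_le[OF _ _ _ B])
        show "0 < \<eta> m" "0 \<le> 2 * \<eta> m" using x0 \<beta>0 by (auto simp: eta_m)
        \<comment> \<open>Within the delay window step sizes are at most twice the current one,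
          hence the choice \<open>2 * \<eta> m\<close> for \<open>a\<close>.\<close>
        show "0 \<le> \<eta> k \<and> \<eta> k \<le> 2 * \<eta> m" if "m - T \<le> k" "k < m" for k
        proof -
          have half: "x / 2 \<le> real k + \<gamma>" using that by (intro x_half) simp
          then have "\<beta> / (real k + \<gamma>) \<le> \<beta> / (x / 2)"
            using x0 \<beta>0 by (intro divide_left_mono) auto
          then show ?thesis using half x0 \<beta>0 by (simp add: eta eta_m[unfolded eta] mult.commute[of \<beta> 2])
        qed
      qed (simp_all add: V_def U_def s_def)
      moreover have "\<eta> m * real T \<le> \<beta> / 2"
      proof -
        have "\<beta> * real T \<le> \<beta> * (x / 2)" using x P \<beta>0 by (intro mult_left_mono) auto
        then show ?thesis using x0 by (simp add: eta_m field_simps)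
      qed
      then have "\<eta> m / \<mu> * (L\<^sup>2 * (real T * (2 * \<eta> m)\<^sup>2 * (real T * U)))
          + \<eta> m * (2 * \<eta> m * (real T * (V + U))) + (\<eta> m)\<^sup>2 * U
          \<le> (\<eta> m)\<^sup>2 * (4 * \<rho> * s + 8 * (20 * L\<^sup>2 + 2 * s) * \<rho> * h m)"
        using \<rho> s H0 mu_pos \<beta>0 x0
        by (intro variance_terms_le[where \<beta> = \<beta>]) (auto simp: V_def U_def eta_m)
      moreover have "(1 - \<mu> * \<eta> m) * mse m \<le> (1 - \<mu> * \<eta> m) * h m"
        using less Suc x x0 by (intro mult_left_mono) (auto simp: eta_m P_def)
      ultimately have "mse (Suc m) \<le> (1 - \<mu> * \<eta> m) * h m
          + (\<eta> m)\<^sup>2 * (4 * \<rho> * s + 8 * C * \<rho> * h m)"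
        unfolding C' by linarith
      also have "\<dots> = (1 - P / x) * h m + (4 * (\<beta>\<^sup>2 * \<rho>) * s + 8 * (C * \<beta>\<^sup>2 * \<rho>) * h m) / x\<^sup>2"
        by (simp add: eta_m P_def power_divide algebra_simps add_divide_distrib)
      finally have "mse (Suc m) \<le> \<delta>1 * s / (x + 1) + \<delta>2 / (x + 1)\<^sup>2"
        using x0 P K[OF x(2)] \<rho>0 s \<delta>2_nonneg
        by (intro rate_recursion[where R = "\<beta>\<^sup>2 * \<rho>" and H = "h m"])
          (auto simp: \<delta>1 P_def h_def x_def mult.assoc)
      then show ?thesis by (simp add: Suc h_def x_def add_ac)
    qed
  qed
  from this[of t] show ?thesis by (simp add: h_def s_def add_ac mult.commute)
qed

section \<open>From the concrete iteration to the abstract method\<close>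

lemma last_active_le:
  assumes "{s. s \<le> t \<and> i \<in> \<A> s} \<noteq> {}"
  shows "last_active \<A> i t \<le> t"
  using Max_in[of "{s. s \<le> t \<and> i \<in> \<A> s}"] assms unfolding last_active_def by auto

lemma gderiv_average_risk:
  fixes f :: "nat \<Rightarrow> 'a::euclidean_space \<Rightarrow> 'x \<Rightarrow> real"
  assumes "\<And>i. i \<in> {1..n} \<Longrightarrow> local_risk \<D> f i differentiable (at v)"
  shows "GDERIV (average_risk n \<D> f) v :> (1 / real n) *\<^sub>R (\<Sum>i=1..n. gradient (local_risk \<D> f i) v)"
proof -
  have "((\<lambda>v. \<Sum>i=1..n. local_risk \<D> f i v) has_derivative
      (\<lambda>h. \<Sum>i=1..n. h \<bullet> gradient (local_risk \<D> f i) v)) (at v)"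
    using differentiable_imp_gderiv_gradient[OF assms]
    by (intro has_derivative_sum) (simp add: gderiv_def)
  then have "((\<lambda>v. (1 / real n) * (\<Sum>i=1..n. local_risk \<D> f i v)) has_derivative
      (\<lambda>h. (1 / real n) * (\<Sum>i=1..n. h \<bullet> gradient (local_risk \<D> f i) v))) (at v)"
    by (rule has_derivative_mult_right)
  then show ?thesis
    unfolding gderiv_def average_risk_def[abs_def] by (simp add: inner_sum_right)
qed

theorem theorem1:
  fixes n T :: nat
    and \<D> :: "nat \<Rightarrow> 'x measure"
    and f :: "nat \<Rightarrow> real ^ 'd \<Rightarrow> 'x \<Rightarrow> real"
    and wstar w0 :: "real ^ 'd"
    and \<A> :: "nat \<Rightarrow> nat set"
    and M :: "'s measure"
    and \<xi> :: "nat \<Rightarrow> nat \<Rightarrow> 's \<Rightarrow> 'x"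
    and w g :: "nat \<Rightarrow> 's \<Rightarrow> real ^ 'd"
    and \<eta> \<E> :: "nat \<Rightarrow> real"
    and \<mu> L \<sigma> \<beta> \<gamma> C_L \<rho> \<delta>1 \<delta>2 :: real
  assumes n: "n \<ge> 1"
    and D_prob: "\<forall>i\<in>{1..n}. prob_space (\<D> i)"
    and f_C1: "\<forall>i\<in>{1..n}. \<forall>x\<in>space (\<D> i). C1_fun (\<lambda>v. f i v x)"
    and f_integrable: "\<forall>i\<in>{1..n}. \<forall>v. integrable (\<D> i) (f i v)"
    and unbiased: "\<forall>i\<in>{1..n}. \<forall>v.
        integrable (\<D> i) (\<lambda>x. gradient (\<lambda>u. f i u x) v) \<and>
        local_risk \<D> f i differentiable (at v) \<and>
        (\<integral>x. gradient (\<lambda>u. f i u x) v \<partial>\<D> i) = gradient (local_risk \<D> f i) v"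
    and wstar: "is_arg_min (average_risk n \<D> f) (\<lambda>_. True) wstar"
    and active: "\<forall>t. \<A> t \<subseteq> {1..n}"
    and tau_defined: "\<forall>i\<in>{1..n}. \<forall>t. {s. s \<le> t \<and> i \<in> \<A> s} \<noteq> {}"
    and M_prob: "prob_space M"
    and samples_distr: "\<forall>i\<in>{1..n}. \<forall>t. \<xi> i t \<in> measurable M (\<D> i) \<and> distr M (\<D> i) (\<xi> i t) = \<D> i"
    and samples_indep:
        "prob_space.indep_vars M (\<lambda>(i, t). \<D> i) (\<lambda>(i, t). \<xi> i t) ({1..n} \<times> (UNIV :: nat set))"
    and step_pos: "\<forall>t. \<eta> t > 0"
    and w_init: "\<forall>\<omega>\<in>space M. w 0 \<omega> = w0"
    and g_def: "\<forall>t. \<forall>\<omega>\<in>space M. g t \<omega> =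
        (\<Sum>i=1..n. gradient (\<lambda>u. f i u (\<xi> i (last_active \<A> i t) \<omega>)) (w (last_active \<A> i t) \<omega>))"
    and w_step: "\<forall>t. \<forall>\<omega>\<in>space M. w (t + 1) \<omega> = w t \<omega> - (\<eta> t / real n) *\<^sub>R g t \<omega>"
    and mu_pos: "\<mu> > 0"
    and F_strongly_convex: "strongly_convex_on \<mu> UNIV (average_risk n \<D> f)"
    and grad_lipschitz:
        "\<forall>i\<in>{1..n}. \<forall>x\<in>space (\<D> i). L-lipschitz_on UNIV (gradient (\<lambda>v. f i v x))"
    and sigma_nonneg: "\<sigma> \<ge> 0"
    and grad_variance: "\<forall>i\<in>{1..n}. \<forall>v.
        integrable (\<D> i) (\<lambda>x. (norm (gradient (\<lambda>u. f i u x) v - gradient (local_risk \<D> f i) v))\<^sup>2) \<and>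
        (\<integral>x. (norm (gradient (\<lambda>u. f i u x) v - gradient (local_risk \<D> f i) v))\<^sup>2 \<partial>\<D> i)
          \<le> \<sigma>\<^sup>2 * (1 + (norm (v - wstar))\<^sup>2)"
    and delay: "\<forall>i\<in>{1..n}. \<forall>t. int (last_active \<A> i t) \<ge> int t - int T"
    and eta_def: "\<forall>t. \<eta> t = \<beta> / (real t + \<gamma>)"
    and C_L_def: "C_L = 20 * L\<^sup>2 + 2 * \<sigma>\<^sup>2 / real n"
    and rho_def: "\<rho> = 1 + 2 * real T + (\<mu> / 2 + 5 * L\<^sup>2 / \<mu>) * \<beta> * real T"
    and beta: "\<beta> > 4 / \<mu>"
    and gamma: "\<gamma> \<ge> 2 * real T +
        max (16 * C_L * \<beta>\<^sup>2 / (\<mu> * \<beta> - 2) * \<rho>) (sqrt (8 * C_L * \<beta>\<^sup>2 / (\<mu> * \<beta> - 4) * \<rho>))"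
    and E_def: "\<forall>t. \<E> t = prob_space.expectation M (\<lambda>\<omega>. (norm (w t \<omega> - wstar))\<^sup>2)"
    and delta1_def: "\<delta>1 = 32 * \<beta>\<^sup>2 * \<rho> / (\<mu> * \<beta> - 2) + 1"
    and delta2_def: "\<delta>2 = \<gamma>\<^sup>2 * \<E> 0"
  shows "\<forall>t. integrable M (\<lambda>\<omega>. (norm (w t \<omega> - wstar))\<^sup>2) \<and>
      \<E> t \<le> \<delta>1 / (\<gamma> + real t) * (\<sigma>\<^sup>2 / real n) + \<delta>2 / (\<gamma> + real t)\<^sup>2"
proof -
  let ?G = "\<lambda>i v x. gradient (\<lambda>u. f i u x) v" and ?m = "\<lambda>i v. gradient (local_risk \<D> f i) v"
  interpret prob_space M by (rule M_prob)
  have F: "GDERIV (average_risk n \<D> f) v :> (1 / real n) *\<^sub>R (\<Sum>i=1..n. ?m i v)" for v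
    using unbiased by (intro gderiv_average_risk) auto
  have min: "average_risk n \<D> f wstar \<le> average_risk n \<D> f v" for v
    using wstar by (simp add: is_arg_min_linorder)
  note sc = strongly_convex_on_minimizer[OF F_strongly_convex F min]
  \<comment> \<open>The sample gradients take the place of \<open>G\<close>, the gradients of the
    local risks that of \<open>mean\<close>. Minimality of \<open>wstar\<close> enters through
    \<open>sc\<close>, which supplies \<open>mean_zero\<close> and
    \<open>mean_monotone\<close>.\<close>
  interpret delayed_gradient_method M n T \<D> ?G ?m wstar w0 "last_active \<A>" \<xi> w \<eta> \<mu> L \<sigma>
  proof (intro delayed_gradient_method.intro delayed_gradient_method_axioms.intro M_prob)
    show "(\<Sum>i=1..n. ?m i wstar) = 0" using sc(1) n by simp
    show "w (Suc t) \<omega> = w t \<omega> - \<eta> t *\<^sub>R ((1 / real n) *\<^sub>R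
        (\<Sum>i=1..n. ?G i (w (last_active \<A> i t) \<omega>) (\<xi> i (last_active \<A> i t) \<omega>)))"
      if "\<omega> \<in> space M" for \<omega> t
      using that w_step g_def by simp
    \<comment> \<open>The delay bound is given over the integers; on naturals it becomes one on the
      truncated difference.\<close>
    show "t - T \<le> last_active \<A> i t" if "i \<in> {1..n}" for i t
    proof -
      have "int t - int T \<le> int (last_active \<A> i t)" using delay that by blast
      then show ?thesis by linarith
    qed
    fix i t v
    assume i: "i \<in> {1..n}"
    show "prob_space (\<D> i)" using D_prob i by blast
    show "integrable (\<D> i) (?G i v)" "(\<integral>x. ?G i v x \<partial>\<D> i) = ?m i v" using unbiased i by blast+
    show "integrable (\<D> i) (\<lambda>x. (norm (?G i v x - ?m i v))\<^sup>2)"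
      "(\<integral>x. (norm (?G i v x - ?m i v))\<^sup>2 \<partial>\<D> i) \<le> \<sigma>\<^sup>2 * (1 + (norm (v - wstar))\<^sup>2)"
      using grad_variance i by blast+
    show "last_active \<A> i t \<le> t" using tau_defined i by (intro last_active_le) blast
    show "\<xi> i t \<in> M \<rightarrow>\<^sub>M \<D> i" "distr M (\<D> i) (\<xi> i t) = \<D> i" using samples_distr i by blast+
    show "L-lipschitz_on UNIV (\<lambda>v. ?G i v x)" if "x \<in> space (\<D> i)" for x
      using grad_lipschitz i that by simp
  next
    show "indep_vars (\<lambda>(i, t). \<D> i) (\<lambda>(i, t). \<xi> i t) ({1..n} \<times> UNIV)" by (rule samples_indep)
    show "\<mu> * (norm (v - wstar))\<^sup>2 \<le> (v - wstar) \<bullet> ((1 / real n) *\<^sub>R (\<Sum>i=1..n. ?m i v))" for v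
      by (rule sc(2))
  qed (use n mu_pos w_init in simp_all)
  have "4 < \<mu> * \<beta>" using beta mu_pos by (simp add: divide_less_eq mult.commute)
  moreover have "1 + 2 * real T + 5 * (L\<^sup>2 * \<beta> * real T / \<mu>) \<le> \<rho>"
  proof -
    \<comment> \<open>The summand of \<open>\<rho>\<close> containing \<open>\<mu> / 2\<close> is
      nonnegative, so \<open>\<rho>\<close> dominates the other summands.\<close>
    have "0 \<le> \<mu> / 2 * \<beta> * real T" using \<open>4 < \<mu> * \<beta>\<close> by simp
    then show ?thesis by (simp add: rho_def algebra_simps)
  qed
  moreover have E: "\<E> t = mse t" for t using E_def by (simp add: mse_def err_def)
  moreover have "2 * real T + 16 * C_L * \<beta>\<^sup>2 / (\<mu> * \<beta> - 2) * \<rho> \<le> \<gamma>" using gamma by simp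
  ultimately have "mse t \<le> \<delta>1 / (\<gamma> + real t) * (\<sigma>\<^sup>2 / real n) + \<delta>2 / (\<gamma> + real t)\<^sup>2" for t
    using eta_def C_L_def delta1_def delta2_def by (intro mse_rate) auto
  \<comment> \<open>The integral of a non-integrable function is 0 by default; integrability shows
    that the bound concerns a genuine expectation.\<close>
  moreover have "integrable M (\<lambda>\<omega>. (norm (w t \<omega> - wstar))\<^sup>2)" for t
    using square_integrable_norm_power2[OF square_integrable_err] by (simp add: err_def)
  ultimately show ?thesis by (simp add: E)
qed

end
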